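(* If $1\leq p<\infty$, then every Banach space $E$ has the property $V^\ast_{(p,p)}$.
   Context: Banach spaces are over $\mathbb{F}\in\{\mathbb{R},\mathbb{C}\}$; $E'_\beta$ denotes the Banach dual of $E$. A sequence $\{\chi_n\}_{n\in\omega}$ in $E'_\beta$ is weakly $p$-summable if $(\langle\eta,\chi_n\rangle)_n\in\ell_p$ for every $\eta\in E''=(E'_\beta)'$. A non-empty subset $A$ of $E$ is a $(p,p)$-$(V^\ast)$ set if $\big(\sup_{a\in A}|\langle\chi_n,a\rangle|\big)_n\in\ell_p$ for every weakly $p$-summable sequence $\{\chi_n\}_{n\in\omega}$ in $E'_\beta$. $E$ has the property $V^\ast_{(p,p)}$ if every $(p,p)$-$(V^\ast)$ set in $E$ is relatively weakly compact. *)

theory Defs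
  imports "HOL-Analysis.Analysis"
begin

text \<open>
  A Banach space over the scalar field \<open>'k\<close> (used for \<open>real\<close> and \<open>complex\<close>). Its additive group,
  norm and completeness come from the type class \<open>banach\<close>. The class only provides a real scalar
  multiplication, so the multiplication by \<open>'k\<close> is an explicit parameter \<open>s\<close> that extends it.
\<close>

locale banach_space_over = vector_space s
  for s :: "'k::real_normed_field \<Rightarrow> 'a::banach \<Rightarrow> 'a" +
  assumes scale_of_real: "s (of_real r) x = r *\<^sub>R x"
    and norm_scale: "norm (s c x) = norm c * norm x"

lemma banach_space_over_scaleR: "banach_space_over (scaleR :: real \<Rightarrow> 'a::banach \<Rightarrow> 'a)"
  by unfold_locales (simp_all add: algebra_simps)

lemma banach_space_over_real_iff:
  fixes s :: "real \<Rightarrow> 'a::banach \<Rightarrow> 'a"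
  shows "banach_space_over s \<longleftrightarrow> s = scaleR"
proof
  assume "banach_space_over s"
  then show "s = scaleR"
    using banach_space_over.scale_of_real[of s] by (intro ext) simp
qed (simp add: banach_space_over_scaleR)

lemma banach_space_over_complex: "banach_space_over ((*) :: complex \<Rightarrow> complex \<Rightarrow> complex)"
  by unfold_locales (simp_all add: algebra_simps scaleR_conv_of_real norm_mult)

text \<open>
  The dual consists of the bounded \<open>'k\<close>-linear functionals (\<open>bounded_linear\<close> by itself only means
  linear over the reals); its norm is the operator norm \<open>onorm\<close>, its operations are pointwise.
\<close>

definition dual_space :: "('k::real_normed_field \<Rightarrow> 'a::banach \<Rightarrow> 'a) \<Rightarrow> ('a \<Rightarrow> 'k) set" where
  "dual_space s = {f. bounded_linear f \<and> (\<forall>c x. f (s c x) = c * f x)}"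

text \<open>Only the values of a member of \<open>bidual_space s\<close> on \<open>dual_space s\<close> are meaningful.\<close>

definition bidual_space ::
    "('k::real_normed_field \<Rightarrow> 'a::banach \<Rightarrow> 'a) \<Rightarrow> (('a \<Rightarrow> 'k) \<Rightarrow> 'k) set" where
  "bidual_space s = {\<eta>.
     (\<forall>f\<in>dual_space s. \<forall>g\<in>dual_space s. \<eta> (\<lambda>x. f x + g x) = \<eta> f + \<eta> g) \<and>
     (\<forall>c. \<forall>f\<in>dual_space s. \<eta> (\<lambda>x. c * f x) = c * \<eta> f) \<and>
     (\<exists>K. \<forall>f\<in>dual_space s. norm (\<eta> f) \<le> K * onorm f)}"

definition in_lp :: "real \<Rightarrow> (nat \<Rightarrow> 'b::real_normed_vector) \<Rightarrow> bool" where
  "in_lp p u \<longleftrightarrow> summable (\<lambda>n. norm (u n) powr p)"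

definition weakly_p_summable_dual ::
    "real \<Rightarrow> ('k::real_normed_field \<Rightarrow> 'a::banach \<Rightarrow> 'a) \<Rightarrow> (nat \<Rightarrow> 'a \<Rightarrow> 'k) \<Rightarrow> bool" where
  "weakly_p_summable_dual p s \<phi> \<longleftrightarrow>
     (\<forall>n. \<phi> n \<in> dual_space s) \<and> (\<forall>\<eta>\<in>bidual_space s. in_lp p (\<lambda>n. \<eta> (\<phi> n)))"

text \<open>
  The \<open>bdd_above\<close> clause says that the suprema are finite; \<open>SUP\<close> over an unbounded set of reals
  has no meaningful value.
\<close>

definition Vstar_set ::
    "real \<Rightarrow> ('k::real_normed_field \<Rightarrow> 'a::banach \<Rightarrow> 'a) \<Rightarrow> 'a set \<Rightarrow> bool" where
  "Vstar_set p s A \<longleftrightarrow> A \<noteq> {} \<and>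
     (\<forall>\<phi>. weakly_p_summable_dual p s \<phi> \<longrightarrow>
        (\<forall>n. bdd_above ((\<lambda>a. norm (\<phi> n a)) ` A)) \<and>
        in_lp p (\<lambda>n. SUP a\<in>A. norm (\<phi> n a)))"

definition weak_topology ::
    "('k::real_normed_field \<Rightarrow> 'a::banach \<Rightarrow> 'a) \<Rightarrow> 'a topology" where
  "weak_topology s = topology_generated_by {f -` U | f U. f \<in> dual_space s \<and> open U}"

lemma topspace_weak_topology [simp]: "topspace (weak_topology s) = UNIV"
proof -
  have "(\<lambda>_. 0) \<in> dual_space s"
    by (simp add: dual_space_def)
  then have "UNIV \<in> {f -` U | f U. f \<in> dual_space s \<and> open U}"
    by (intro CollectI exI[of _ "\<lambda>_. 0"] exI[of _ UNIV]) simp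
  then show ?thesis
    unfolding weak_topology_def topology_generated_by_topspace by blast
qed

definition relatively_weakly_compact ::
    "('k::real_normed_field \<Rightarrow> 'a::banach \<Rightarrow> 'a) \<Rightarrow> 'a set \<Rightarrow> bool" where
  "relatively_weakly_compact s A \<longleftrightarrow>
     compactin (weak_topology s) (weak_topology s closure_of A)"

definition property_Vstar ::
    "real \<Rightarrow> ('k::real_normed_field \<Rightarrow> 'a::banach \<Rightarrow> 'a) \<Rightarrow> bool" where
  "property_Vstar p s \<longleftrightarrow> (\<forall>A. Vstar_set p s A \<longrightarrow> relatively_weakly_compact s A)"

end

theory Submission
  imports Defs "HOL-Library.Function_Algebras"
begin

text \<open>
  Let \<open>A\<close> be a \<open>(p,p)\<close>-\<open>(V\<^sup>*)\<close> set in a Banach space \<open>E\<close>. The hypothesis says that the operator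
  \<open>T : f \<mapsto> (f a)\<^bsub>a \<in> A\<^esub>\<close> from the dual of \<open>E\<close> to \<open>\<ell>\<^sub>\<infinity>(A)\<close> maps weakly \<open>p\<close>-summable
  sequences to absolutely \<open>p\<close>-summable ones. Such an operator is \<open>r\<close>-summing for every \<open>r \<ge> p\<close>; for
  \<open>r > 1\<close> it factors through a subspace of an \<open>L\<^sub>r\<close> space by Pietsch's theorem, hence is weakly compact.
  The adjoint of \<open>T\<close> is then weakly compact too. It maps the evaluations at the points of \<open>A\<close>, which
  form a bounded set, to the points of \<open>A\<close> itself.

  The proof below follows this idea, but replaces measures, \<open>L\<^sub>r\<close> spaces and reflexivity by elementary
  counterparts. A gluing argument (\<open>Vstar_set_summing\<close>) gives a uniform \<open>p\<close>-summing inequality for finite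
  families of functionals. The Hahn-Banach theorem (\<open>sublinear_dominates_linear\<close>) turns it into a positive
  functional \<open>\<Lambda>\<close> on the bounded functions on the unit ball of \<open>E\<close> with
  \<open>sup\<^bsub>a \<in> A\<^esub> \<bar>f a\<bar>\<^bsup>p\<^esup> \<le> \<Lambda> (\<bar>f\<bar>\<^bsup>p\<^esup>)\<close> for all \<open>f\<close> in the dual (\<open>Vstar_set_pietsch\<close>). The exponent can be raised to an
  even number \<open>n\<close>, for which \<open>f \<mapsto> \<Lambda> (\<bar>f\<bar>\<^bsup>n\<^esup>)\<^bsup>1/n\<^esup>\<close> is a uniformly smooth seminorm
  (\<open>norm_even_power_smoothness\<close>).

  The dual of a uniformly smooth seminorm is uniformly convex, and \<open>A\<close> is bounded for this dual norm,
  which dominates a multiple of the norm of \<open>E\<close>. As in the Milman-Pettis theorem, uniform convexity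
  forces every pointwise limit \<open>\<eta>\<close> of elements of \<open>A\<close> on the dual to be approximable by a norm Cauchy
  family in \<open>E\<close>, so \<open>\<eta>\<close> is the evaluation at a point of \<open>E\<close> (\<open>pointwise_limit_is_evaluation\<close>). Together with
  Tychonoff's theorem this is relative weak compactness (\<open>relatively_weakly_compactI\<close>).
\<close>

section \<open>Sublinear functionals and Hahn-Banach\<close>

definition sublinear_on :: "(real \<Rightarrow> 'v::ab_group_add \<Rightarrow> 'v) \<Rightarrow> 'v set \<Rightarrow> ('v \<Rightarrow> real) \<Rightarrow> bool" where
  "sublinear_on sc S q \<longleftrightarrow>
     (\<forall>x\<in>S. \<forall>y\<in>S. q (x + y) \<le> q x + q y) \<and> (\<forall>x\<in>S. \<forall>c\<ge>0. q (sc c x) = c * q x)"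

locale real_subspace = vector_space sc
  for sc :: "real \<Rightarrow> 'v::ab_group_add \<Rightarrow> 'v" +
  fixes S :: "'v set"
  assumes subspace_S: "subspace S"
begin

lemma S_closed [simp]:
  "0 \<in> S" "x \<in> S \<Longrightarrow> y \<in> S \<Longrightarrow> x + y \<in> S" "x \<in> S \<Longrightarrow> sc c x \<in> S" "x \<in> S \<Longrightarrow> - x \<in> S"
  using subspace_S subspace_0 subspace_add subspace_scale subspace_neg by blast+

lemma sublinear_onD:
  assumes "sublinear_on sc S q"
  shows sublinear_on_add: "x \<in> S \<Longrightarrow> y \<in> S \<Longrightarrow> q (x + y) \<le> q x + q y"
    and sublinear_on_scale: "x \<in> S \<Longrightarrow> 0 \<le> c \<Longrightarrow> q (sc c x) = c * q x"
    and sublinear_on_zero: "q 0 = 0"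
    and sublinear_on_neg: "x \<in> S \<Longrightarrow> - q (- x) \<le> q x"
proof -
  show *: "x \<in> S \<Longrightarrow> y \<in> S \<Longrightarrow> q (x + y) \<le> q x + q y" for x y
    using assms by (auto simp: sublinear_on_def)
  show **: "x \<in> S \<Longrightarrow> 0 \<le> c \<Longrightarrow> q (sc c x) = c * q x" for x c
    using assms by (auto simp: sublinear_on_def)
  show ***: "q 0 = 0"
    using **[of 0 0] by simp
  show "x \<in> S \<Longrightarrow> - q (- x) \<le> q x"
    using *[of x "- x"] *** by simp
qed

text \<open>
  The functional \<open>r x = inf\<^bsub>t \<ge> 0\<^esub> (q (x + t y) - t q y)\<close> is the largest sublinear minorant of \<open>q\<close> for which
  \<open>y\<close> satisfies \<open>r (- y) = - q y\<close>: passing from \<open>q\<close> to \<open>r\<close> makes \<open>q\<close> additive in the direction \<open>y\<close>.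
  It serves twice: it shows that a minimal sublinear functional is linear, and it prescribes the
  value of a linear minorant at one point.
\<close>

lemma sublinear_on_steepest:
  assumes q: "sublinear_on sc S q" and y: "y \<in> S"
  obtains r where "sublinear_on sc S r" "\<And>x t. x \<in> S \<Longrightarrow> 0 \<le> t \<Longrightarrow> r x \<le> q (x + sc t y) - t * q y"
    "\<And>x. x \<notin> S \<Longrightarrow> r x = 0"
proof -
  define f where "f x t = q (x + sc t y) - t * q y" for x t
  define r where "r x = (if x \<in> S then INF t\<in>{0..}. f x t else 0)" for x
  have lower: "- q (- x) \<le> f x t" if "x \<in> S" "0 \<le> t" for x t
  proof -
    have "t * q y = q ((x + sc t y) + (- x))"
      using sublinear_on_scale[OF q y \<open>0 \<le> t\<close>] by simp
    also have "\<dots> \<le> q (x + sc t y) + q (- x)"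
      by (rule sublinear_on_add[OF q]) (use that y in auto)
    finally show ?thesis by (simp add: f_def)
  qed
  have bdd: "bdd_below (f x ` {0..})" if "x \<in> S" for x
    by (rule bdd_belowI2[of _ "- q (- x)"]) (use lower that in auto)
  have le: "r x \<le> f x t" if "x \<in> S" "0 \<le> t" for x t
    unfolding r_def using that bdd by (auto intro!: cINF_lower)
  have ge: "z \<le> r x" if "x \<in> S" "\<And>t. 0 \<le> t \<Longrightarrow> z \<le> f x t" for x z
    unfolding r_def using that by (auto intro!: cINF_greatest)
  have add: "r (x + x') \<le> r x + r x'" if x: "x \<in> S" "x' \<in> S" for x x'
  proof -
    have "r (x + x') - f x t \<le> f x' t'" if t: "0 \<le> t" "0 \<le> t'" for t t'
    proof -
      have "r (x + x') \<le> f (x + x') (t + t')"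
        using x t by (intro le) auto
      also have "\<dots> \<le> f x t + f x' t'"
        using sublinear_on_add[OF q, of "x + sc t y" "x' + sc t' y"] x y
        by (simp add: f_def algebra_simps)
      finally show ?thesis by simp
    qed
    then have "r (x + x') - f x t \<le> r x'" if "0 \<le> t" for t
      using x that by (intro ge) auto
    then have "r (x + x') - r x' \<le> f x t" if "0 \<le> t" for t
      using that by (simp add: algebra_simps)
    then have "r (x + x') - r x' \<le> r x"
      using x by (intro ge) auto
    then show ?thesis by simp
  qed
  have r0: "r 0 = 0"
  proof (rule antisym)
    show "r 0 \<le> 0"
      using le[of 0 0] sublinear_on_zero[OF q] by (simp add: f_def)
    show "0 \<le> r 0"
      by (rule ge) (use sublinear_on_scale[OF q y] in \<open>auto simp: f_def\<close>)
  qed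
  have scale_le: "r (sc c x) \<le> c * r x" if x: "x \<in> S" and c: "0 < c" for c x
  proof -
    have "r (sc c x) / c \<le> f x t" if "0 \<le> t" for t
    proof -
      have "r (sc c x) \<le> f (sc c x) (c * t)"
        using x c that by (intro le) auto
      also have "f (sc c x) (c * t) = c * f x t"
      proof -
        have "sc c x + sc (c * t) y = sc c (x + sc t y)"
          by (simp add: scale_right_distrib)
        then show ?thesis
          using sublinear_on_scale[OF q, of "x + sc t y" c] x y c
          by (simp add: f_def algebra_simps)
      qed
      finally show ?thesis using c by (simp add: field_simps)
    qed
    then have "r (sc c x) / c \<le> r x"
      using x by (intro ge) auto
    then show ?thesis using c by (simp add: field_simps)
  qed
  have "r (sc c x) = c * r x" if x: "x \<in> S" and c: "0 \<le> c" for c x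
  proof (cases "c = 0")
    case False
    then have c: "c > 0" using c by simp
    have "r x \<le> inverse c * r (sc c x)"
      using scale_le[of "sc c x" "inverse c"] x c by simp
    then have "c * r x \<le> r (sc c x)"
      using c by (simp add: field_simps)
    then show ?thesis using scale_le[OF x c] by simp
  qed (simp add: r0)
  then have "sublinear_on sc S r"
    using add by (auto simp: sublinear_on_def)
  then show ?thesis
    by (rule that) (use le in \<open>auto simp: f_def r_def\<close>)
qed

text \<open>
  Zorn's lemma: the pointwise infimum of a chain of sublinear minorants of \<open>p\<close> is again one, because
  \<open>- p (- x)\<close> bounds all of them from below. The functionals are normalised to vanish off \<open>S\<close>, so that
  the pointwise order is antisymmetric.
\<close>

lemma sublinear_minorant_minimal:
  assumes p: "sublinear_on sc S p"
  obtains q where "sublinear_on sc S q" "\<And>x. x \<in> S \<Longrightarrow> q x \<le> p x"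
    "\<And>r. sublinear_on sc S r \<Longrightarrow> (\<And>x. x \<in> S \<Longrightarrow> r x \<le> q x) \<Longrightarrow> (\<And>x. x \<notin> S \<Longrightarrow> r x = 0) \<Longrightarrow> r = q"
proof -
  define Q where "Q = {q. sublinear_on sc S q \<and> (\<forall>x\<in>S. q x \<le> p x) \<and> (\<forall>x. x \<notin> S \<longrightarrow> q x = 0)}"
  define above :: "('v \<Rightarrow> real) \<Rightarrow> ('v \<Rightarrow> real) \<Rightarrow> bool" where "above = (\<lambda>q r. r \<le> q)"
  have "\<exists>m\<in>Q. \<forall>a\<in>Q. above m a \<longrightarrow> a = m"
  proof (rule predicate_Zorn)
    show "partial_order_on Q (relation_of above Q)"
      by (auto simp: partial_order_on_def preorder_on_def relation_of_def above_def
          refl_on_def trans_def antisym_def)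
  next
    fix C assume "C \<in> Chains (relation_of above Q)"
    then have CQ: "q \<in> Q" and chain: "r \<in> C \<Longrightarrow> q \<le> r \<or> r \<le> q" if "q \<in> C" for q r
      using that by (auto simp: Chains_def relation_of_def above_def)
    show "\<exists>u\<in>Q. \<forall>a\<in>C. above a u"
    proof (cases "C = {}")
      case True
      define u where "u x = (if x \<in> S then p x else 0)" for x
      have "u \<in> Q"
        using p by (auto simp: Q_def u_def sublinear_on_def)
      then show ?thesis using True by auto
    next
      case False
      define u where "u x = (INF q\<in>C. q x)" for x
      have zero: "q x = 0" if "q \<in> C" "x \<notin> S" for q x
        using CQ[OF that(1)] that(2) by (simp add: Q_def)
      have lower: "- p (- x) \<le> q x" if "q \<in> C" "x \<in> S" for q x
      proof -
        have "q (- x) \<le> p (- x)" "- q (- x) \<le> q x"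
          using CQ[OF that(1)] sublinear_on_neg[of q x] that(2) by (auto simp: Q_def)
        then show ?thesis by simp
      qed
      have bdd: "bdd_below ((\<lambda>q. q x) ` C)" for x
      proof (cases "x \<in> S")
        case True
        then show ?thesis by (intro bdd_belowI2[of _ "- p (- x)"]) (use lower in auto)
      next
        case False
        then show ?thesis by (intro bdd_belowI2[of _ 0] eq_refl) (metis zero)
      qed
      have le: "u x \<le> q x" if "q \<in> C" for q x
        unfolding u_def using that bdd by (auto intro!: cINF_lower)
      have ge: "z \<le> u x" if "\<And>q. q \<in> C \<Longrightarrow> z \<le> q x" for x z
        unfolding u_def using that False by (auto intro!: cINF_greatest)
      have vanish: "u x = 0" if "\<And>q. q \<in> C \<Longrightarrow> q x = 0" for x
      proof (rule antisym)
        obtain q where "q \<in> C" using False by auto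
        then show "u x \<le> 0" using le[of q x] that[of q] by simp
        show "0 \<le> u x" by (rule ge) (metis that order_refl)
      qed
      have "u (x + y) \<le> u x + u y" if x: "x \<in> S" "y \<in> S" for x y
      proof -
        have "u (x + y) - q x \<le> r y" if qr: "q \<in> C" "r \<in> C" for q r
        proof -
          obtain m where m: "m \<in> C" "m \<le> q" "m \<le> r"
            using chain[OF qr] qr by blast
          have "u (x + y) \<le> m (x + y)"
            using m le by simp
          also have "\<dots> \<le> m x + m y"
            using CQ[OF m(1)] x by (auto simp: Q_def sublinear_on_def)
          also have "\<dots> \<le> q x + r y"
            using m by (intro add_mono) (auto simp: le_fun_def)
          finally show ?thesis by simp
        qed
        then have "u (x + y) - q x \<le> u y" if "q \<in> C" for q
          using that by (intro ge) auto
        then have "u (x + y) - u y \<le> q x" if "q \<in> C" for q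
          using that by (simp add: algebra_simps)
        then have "u (x + y) - u y \<le> u x"
          by (rule ge)
        then show ?thesis by simp
      qed
      moreover have "u (sc c x) = c * u x" if x: "x \<in> S" and c: "0 \<le> c" for c x
      proof (cases "c = 0")
        case True
        have "q 0 = 0" if "q \<in> C" for q
          using CQ[OF that] sublinear_on_zero by (auto simp: Q_def)
        then have "u 0 = 0"
          by (intro vanish)
        then show ?thesis using True by simp
      next
        case False
        then have c: "c > 0" using c by simp
        have eq: "q (sc c x) = c * q x" if "q \<in> C" for q
          using CQ[OF that] x c by (auto simp: Q_def sublinear_on_def)
        have "u (sc c x) / c \<le> u x"
        proof (rule ge)
          show "u (sc c x) / c \<le> q x" if "q \<in> C" for q
            using le[OF that, of "sc c x"] eq[OF that] c by (simp add: field_simps)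
        qed
        moreover have "c * u x \<le> u (sc c x)"
        proof (rule ge)
          show "c * u x \<le> q (sc c x)" if "q \<in> C" for q
            using le[OF that, of x] eq[OF that] c by simp
        qed
        ultimately show ?thesis using c by (simp add: field_simps)
      qed
      ultimately have "sublinear_on sc S u"
        by (auto simp: sublinear_on_def)
      moreover obtain q where "q \<in> C" using False by auto
      then have "\<forall>x\<in>S. u x \<le> p x"
        using le CQ by (fastforce simp: Q_def intro: order_trans)
      moreover have "u x = 0" if "x \<notin> S" for x
        using zero that by (intro vanish)
      ultimately have "u \<in> Q" by (auto simp: Q_def)
      then show ?thesis using le by (auto simp: above_def le_fun_def)
    qed
  qed
  then obtain q where q: "q \<in> Q" and min: "\<And>r. r \<in> Q \<Longrightarrow> r \<le> q \<Longrightarrow> r = q"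
    by (auto simp: above_def)
  show ?thesis
  proof (rule that)
    show "sublinear_on sc S q" "\<And>x. x \<in> S \<Longrightarrow> q x \<le> p x"
      using q by (auto simp: Q_def)
    fix r assume r: "sublinear_on sc S r" "\<And>x. x \<in> S \<Longrightarrow> r x \<le> q x" "\<And>x. x \<notin> S \<Longrightarrow> r x = 0"
    show "r = q"
    proof (rule min)
      show "r \<le> q"
        unfolding le_fun_def using r q by (metis (mono_tags, lifting) Q_def mem_Collect_eq order_refl)
      show "r \<in> Q" using r q by (fastforce simp: Q_def intro: order_trans)
    qed
  qed
qed

text \<open>
  Hahn-Banach in its sublinear form. For a minimal \<open>q\<close> the minorant of \<open>q\<close> that is steepest in the
  direction \<open>y\<close> must be \<open>q\<close> itself; at \<open>t = 1\<close> this says \<open>q x + q y \<le> q (x + y)\<close>, so \<open>q\<close> is additive.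
\<close>

theorem sublinear_dominates_linear:
  assumes p: "sublinear_on sc S p"
  obtains f where "\<And>x y. x \<in> S \<Longrightarrow> y \<in> S \<Longrightarrow> f (x + y) = f x + f y"
    "\<And>c x. x \<in> S \<Longrightarrow> f (sc c x) = c * f x" "\<And>x. x \<in> S \<Longrightarrow> f x \<le> p x"
proof -
  obtain q where q: "sublinear_on sc S q" "\<And>x. x \<in> S \<Longrightarrow> q x \<le> p x"
    and min: "\<And>r. sublinear_on sc S r \<Longrightarrow> (\<And>x. x \<in> S \<Longrightarrow> r x \<le> q x) \<Longrightarrow>
      (\<And>x. x \<notin> S \<Longrightarrow> r x = 0) \<Longrightarrow> r = q"
    using sublinear_minorant_minimal[OF p] by metis
  have add: "q (x + y) = q x + q y" if xy: "x \<in> S" "y \<in> S" for x y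
  proof -
    obtain r where r: "sublinear_on sc S r" "\<And>x. x \<notin> S \<Longrightarrow> r x = 0"
      and le: "\<And>x t. x \<in> S \<Longrightarrow> 0 \<le> t \<Longrightarrow> r x \<le> q (x + sc t y) - t * q y"
      using sublinear_on_steepest[OF q(1) xy(2)] by metis
    have "r z \<le> q z" if "z \<in> S" for z
      using le[OF that, of 0] by simp
    then have "r = q" using r by (intro min) auto
    then show ?thesis
      using le[of x 1] sublinear_on_add[OF q(1) xy] xy by simp
  qed
  have neg: "q (- x) = - q x" if "x \<in> S" for x
    using add[of x "- x"] that sublinear_on_zero[OF q(1)] by simp
  have "q (sc c x) = c * q x" if x: "x \<in> S" for c x
  proof (cases "0 \<le> c")
    case True
    then show ?thesis using sublinear_on_scale[OF q(1) x] by simp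
  next
    case False
    then show ?thesis
      using sublinear_on_scale[OF q(1) x, of "- c"] neg[of "sc c x"] x by simp
  qed
  then show ?thesis using that add q(2) by blast
qed

end

section \<open>Norming functionals\<close>

text \<open>
  The steepest sublinear minorant of the norm in the direction \<open>x0\<close> is at most \<open>- norm x0\<close> at \<open>- x0\<close>,
  and every linear functional below it inherits this.
\<close>

lemma exists_real_norming_functional:
  fixes x0 :: "'a::real_normed_vector"
  obtains f :: "'a \<Rightarrow> real" where "linear f" "\<And>x. \<bar>f x\<bar> \<le> norm x" "f x0 = norm x0"
proof -
  interpret real_subspace "scaleR :: real \<Rightarrow> 'a \<Rightarrow> 'a" UNIV
    by (intro real_subspace.intro real_subspace_axioms.intro module.subspace_UNIV)
       (unfold_locales, auto simp: algebra_simps)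
  have "sublinear_on scaleR UNIV (norm :: 'a \<Rightarrow> real)"
    by (auto simp: sublinear_on_def norm_triangle_ineq)
  then obtain r where r: "sublinear_on scaleR UNIV r"
    and r_le: "\<And>x t. 0 \<le> t \<Longrightarrow> r x \<le> norm (x + t *\<^sub>R x0) - t * norm x0"
    using sublinear_on_steepest[of norm x0] by (metis UNIV_I)
  obtain f where f: "\<And>x y. f (x + y) = f x + f y" "\<And>c x. f (c *\<^sub>R x) = c * f x" "\<And>x. f x \<le> r x"
    using sublinear_dominates_linear[OF r] by (metis UNIV_I)
  show ?thesis
  proof (rule that)
    show lin: "linear f"
      by (rule linearI) (simp_all add: f)
    have le: "f x \<le> norm x" for x
      using f(3)[of x] r_le[of 0 x] by simp
    show "\<bar>f x\<bar> \<le> norm x" for x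
      using le[of x] le[of "- x"] linear_neg[OF lin, of x] by (simp add: abs_le_iff)
    have "f (- x0) \<le> - norm x0"
      using f(3)[of "- x0"] r_le[of 1 "- x0"] by simp
    then show "f x0 = norm x0"
      using le[of x0] linear_neg[OF lin, of x0] by simp
  qed
qed

definition norming_dual :: "('k::real_normed_field \<Rightarrow> 'a::banach \<Rightarrow> 'a) \<Rightarrow> bool" where
  "norming_dual s \<longleftrightarrow> (\<forall>x. \<exists>f\<in>dual_space s. (\<forall>y. norm (f y) \<le> norm y) \<and> norm (f x) = norm x)"

lemma norming_dual_real:
  fixes s :: "real \<Rightarrow> 'a::banach \<Rightarrow> 'a"
  assumes "banach_space_over s"
  shows "norming_dual s"
  unfolding norming_dual_def
proof
  fix x0 :: 'a
  have s: "s = scaleR"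
    using assms by (simp add: banach_space_over_real_iff)
  obtain f :: "'a \<Rightarrow> real" where f: "linear f" "\<And>x. \<bar>f x\<bar> \<le> norm x" "f x0 = norm x0"
    using exists_real_norming_functional by metis
  have "bounded_linear f"
    using f by (intro bounded_linear.intro bounded_linear_axioms.intro exI[of _ 1]) auto
  then have "f \<in> dual_space s"
    using linear_scale[OF f(1)] by (auto simp: dual_space_def s)
  then show "\<exists>f\<in>dual_space s. (\<forall>y. norm (f y) \<le> norm y) \<and> norm (f x0) = norm x0"
    using f by (intro bexI[of _ f]) auto
qed

text \<open>
  The complexification \<open>x \<mapsto> f x - \<i> f (\<i> x)\<close> of a real norming functional keeps its bound, because a
  rotation of \<open>x\<close> makes its value real, hence equal to a value of \<open>f\<close>.
\<close>

lemma norming_dual_complex: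
  fixes s :: "complex \<Rightarrow> 'a::banach \<Rightarrow> 'a"
  assumes "banach_space_over s"
  shows "norming_dual s"
  unfolding norming_dual_def
proof
  interpret banach_space_over s by fact
  fix x0 :: 'a
  obtain f :: "'a \<Rightarrow> real" where f: "linear f" "\<And>x. \<bar>f x\<bar> \<le> norm x" "f x0 = norm x0"
    using exists_real_norming_functional by metis
  define g where "g x = Complex (f x) (- f (s \<i> x))" for x
  have s_add: "s c (x + y) = s c x + s c y" for c x y
    by (simp add: scale_right_distrib)
  have s_real: "s (complex_of_real r) x = r *\<^sub>R x" for r x
    by (rule scale_of_real)
  have s_Complex: "s c x = Re c *\<^sub>R x + Im c *\<^sub>R s \<i> x" for c x
  proof -
    have "s c x = s (complex_of_real (Re c) + complex_of_real (Im c) * \<i>) x"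
      by (simp add: complex_eq mult.commute)
    also have "\<dots> = Re c *\<^sub>R x + Im c *\<^sub>R s \<i> x"
      by (simp add: scale_left_distrib s_real flip: scale_scale)
    finally show ?thesis .
  qed
  have s_ii: "s \<i> (s \<i> x) = - x" for x
    using s_real[of "-1" x] by simp
  have s_R: "s \<i> (r *\<^sub>R x) = r *\<^sub>R s \<i> x" for r x
    by (simp add: mult.commute flip: s_real)
  have g_add: "g (x + y) = g x + g y" for x y
    by (simp add: g_def s_add linear_add[OF f(1)] complex_eq_iff)
  have g_s: "g (s c x) = c * g x" for c x
    unfolding g_def s_Complex[of c]
    by (simp add: s_add s_R s_ii linear_add[OF f(1)] linear_scale[OF f(1)] linear_neg[OF f(1)]
        linear_diff[OF f(1)] complex_eq_iff algebra_simps)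
  have g_le: "norm (g x) \<le> norm x" for x
  proof (cases "g x = 0")
    case False
    define u where "u = of_real (norm (g x)) / g x"
    have u: "norm u = 1" "g (s u x) = of_real (norm (g x))"
      using False by (simp_all add: u_def norm_divide g_s)
    have "norm (g x) = f (s u x)"
      using u(2) by (simp add: g_def complex_eq_iff)
    also have "\<dots> \<le> norm x"
      using f(2)[of "s u x"] by (simp add: norm_scale u)
    finally show ?thesis .
  qed simp
  have "bounded_linear g"
    using g_add g_s g_le by (intro bounded_linear_intro[of _ 1])
       (auto simp: scaleR_conv_of_real simp flip: s_real)
  then have "g \<in> dual_space s"
    by (simp add: dual_space_def g_s)
  moreover have "norm (g x0) = norm x0"
    using g_le[of x0] abs_Re_le_cmod[of "g x0"] f(3) by (simp add: g_def)
  ultimately show "\<exists>f\<in>dual_space s. (\<forall>y. norm (f y) \<le> norm y) \<and> norm (f x0) = norm x0"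
    using g_le by blast
qed

section \<open>Domination by a finitely additive measure\<close>

definition bounded_functions :: "'b set \<Rightarrow> ('b \<Rightarrow> real) set" where
  "bounded_functions B = {f. \<exists>M. \<forall>x\<in>B. \<bar>f x\<bar> \<le> M}"

lemma bounded_functionsI: "(\<And>x. x \<in> B \<Longrightarrow> \<bar>f x\<bar> \<le> M) \<Longrightarrow> f \<in> bounded_functions B"
  by (auto simp: bounded_functions_def)

lemma bounded_functions_add:
  assumes "f \<in> bounded_functions B" "g \<in> bounded_functions B"
  shows "(\<lambda>x. f x + g x) \<in> bounded_functions B"
proof -
  obtain M N where "\<And>x. x \<in> B \<Longrightarrow> \<bar>f x\<bar> \<le> M" "\<And>x. x \<in> B \<Longrightarrow> \<bar>g x\<bar> \<le> N"
    using assms by (auto simp: bounded_functions_def)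
  then show ?thesis
    by (intro bounded_functionsI[of _ _ "M + N"]) (smt (verit))
qed

lemma bounded_functions_scale:
  assumes "f \<in> bounded_functions B"
  shows "(\<lambda>x. c * f x) \<in> bounded_functions B"
proof -
  obtain M where "\<And>x. x \<in> B \<Longrightarrow> \<bar>f x\<bar> \<le> M"
    using assms by (auto simp: bounded_functions_def)
  then show ?thesis
    by (intro bounded_functionsI[of _ _ "\<bar>c\<bar> * M"]) (simp add: abs_mult mult_left_mono)
qed

lemma real_subspace_bounded_functions:
  "real_subspace (\<lambda>c f x. c * f x) (bounded_functions B)"
proof (intro real_subspace.intro real_subspace_axioms.intro)
  show vs: "vector_space (\<lambda>c (f :: 'a \<Rightarrow> real) x. c * f x)"
    by unfold_locales (auto simp: fun_eq_iff algebra_simps)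
  show "module.subspace (\<lambda>c f x. c * f x) (bounded_functions B)"
  proof (rule module.subspaceI)
    show "module (\<lambda>c (f :: 'a \<Rightarrow> real) x. c * f x)"
      using vs by (simp add: module_iff_vector_space)
  qed (auto simp: plus_fun_def zero_fun_def intro: bounded_functions_add bounded_functions_scale
        bounded_functionsI[of _ _ 0])
qed

text \<open>
  Such a functional is positive: \<open>f \<le> 0\<close> on \<open>B\<close> forces \<open>\<Lambda> f \<le> 0\<close>. It is integration against a finitely
  additive measure on \<open>B\<close> of total mass at most \<open>K\<close>.
\<close>

definition dominated_functional :: "'b set \<Rightarrow> real \<Rightarrow> (('b \<Rightarrow> real) \<Rightarrow> real) \<Rightarrow> bool" where
  "dominated_functional B K \<Lambda> \<longleftrightarrow>
     (\<forall>f\<in>bounded_functions B. \<forall>g\<in>bounded_functions B. \<Lambda> (\<lambda>x. f x + g x) = \<Lambda> f + \<Lambda> g) \<and>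
     (\<forall>f\<in>bounded_functions B. \<forall>c. \<Lambda> (\<lambda>x. c * f x) = c * \<Lambda> f) \<and>
     (\<forall>f\<in>bounded_functions B. \<forall>M. (\<forall>x\<in>B. f x \<le> M) \<longrightarrow> \<Lambda> f \<le> K * M)"

lemma dominated_functionalD:
  assumes "dominated_functional B K \<Lambda>" "f \<in> bounded_functions B"
  shows dominated_functional_add:
      "g \<in> bounded_functions B \<Longrightarrow> \<Lambda> (\<lambda>x. f x + g x) = \<Lambda> f + \<Lambda> g"
    and dominated_functional_scale: "\<Lambda> (\<lambda>x. c * f x) = c * \<Lambda> f"
    and dominated_functional_le: "(\<And>x. x \<in> B \<Longrightarrow> f x \<le> M) \<Longrightarrow> \<Lambda> f \<le> K * M"
  using assms unfolding dominated_functional_def by blast+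

lemma dominated_functional_mono:
  assumes \<Lambda>: "dominated_functional B K \<Lambda>"
    and fg: "f \<in> bounded_functions B" "g \<in> bounded_functions B" "\<And>x. x \<in> B \<Longrightarrow> f x \<le> g x"
  shows "\<Lambda> f \<le> \<Lambda> g"
proof -
  have neg: "(\<lambda>x. (- 1) * g x) \<in> bounded_functions B"
    using fg(2) by (rule bounded_functions_scale)
  have "\<Lambda> (\<lambda>x. f x + (- 1) * g x) \<le> K * 0"
    using fg by (intro dominated_functional_le[OF \<Lambda>] bounded_functions_add neg) auto
  moreover have "\<Lambda> (\<lambda>x. f x + (- 1) * g x) = \<Lambda> f + (- 1) * \<Lambda> g"
    by (simp only: dominated_functional_add[OF \<Lambda> fg(1) neg] dominated_functional_scale[OF \<Lambda> fg(2)])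
  ultimately show ?thesis by simp
qed

text \<open>
  Pietsch domination in abstract form: a family of inequalities \<open>b \<le> K sup\<^bsub>B\<^esub> g\<close>, stable under positive
  combinations, is witnessed by one measure. The functional
  \<open>P f = inf {K sup\<^bsub>B\<^esub> (f + g) - b | (g, b) \<in> cone}\<close> is sublinear, and the hypothesis says exactly that it
  does not degenerate at \<open>0\<close>. A linear minorant \<open>L\<close> of \<open>P\<close> satisfies \<open>L f \<le> K sup\<^bsub>B\<^esub> f\<close> (choose
  \<open>(g, b) = (0, 0)\<close>) and \<open>L (- g) \<le> - b\<close>.
\<close>

lemma pietsch_domination:
  fixes cone :: "(('b \<Rightarrow> real) \<times> real) set" and B :: "'b set" and K :: real
  assumes zero: "(\<lambda>x. 0, 0) \<in> cone"
    and add: "\<And>g b h c. (g, b) \<in> cone \<Longrightarrow> (h, c) \<in> cone \<Longrightarrow> (\<lambda>x. g x + h x, b + c) \<in> cone"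
    and scale: "\<And>g b t. (g, b) \<in> cone \<Longrightarrow> 0 < t \<Longrightarrow> (\<lambda>x. t * g x, t * b) \<in> cone"
    and bounded: "\<And>g b. (g, b) \<in> cone \<Longrightarrow> g \<in> bounded_functions B"
    and dominated: "\<And>g b M. (g, b) \<in> cone \<Longrightarrow> (\<And>x. x \<in> B \<Longrightarrow> g x \<le> M) \<Longrightarrow> b \<le> K * M"
  obtains L where "dominated_functional B K L" "\<And>g b. (g, b) \<in> cone \<Longrightarrow> b \<le> L g"
proof -
  let ?S = "bounded_functions B" and ?sc = "\<lambda>c f x. c * f x :: real"
  interpret real_subspace ?sc ?S
    by (rule real_subspace_bounded_functions)
  \<comment> \<open>Each bound \<open>M\<close> of \<open>f + g\<close> stands for the supremum in the formula for \<open>P\<close>.\<close>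
  define V where "V f = {K * M - b | M b. \<exists>g. (g, b) \<in> cone \<and> (\<forall>x\<in>B. f x + g x \<le> M)}" for f
  define P where "P f = Inf (V f)" for f
  have V_I: "K * M - b \<in> V f" if "(g, b) \<in> cone" "\<And>x. x \<in> B \<Longrightarrow> f x + g x \<le> M" for f g b M
    using that by (auto simp: V_def)
  have V_bdd: "bdd_below (V f)" if f: "f \<in> ?S" for f
  proof -
    obtain N where N: "\<And>x. x \<in> B \<Longrightarrow> \<bar>f x\<bar> \<le> N"
      using f by (auto simp: bounded_functions_def)
    have "- K * N \<le> v" if v: "v \<in> V f" for v
    proof -
      obtain M g b where v: "v = K * M - b" "(g, b) \<in> cone" "\<And>x. x \<in> B \<Longrightarrow> f x + g x \<le> M"
        using v by (auto simp: V_def)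
      have "b \<le> K * (M + N)"
      proof (rule dominated[OF v(2)])
        show "g x \<le> M + N" if "x \<in> B" for x
          using N[OF that] v(3)[OF that] by linarith
      qed
      then show ?thesis by (simp add: v(1) algebra_simps)
    qed
    then show ?thesis by (rule bdd_belowI)
  qed
  have V_ne: "V f \<noteq> {}" if f: "f \<in> ?S" for f
  proof -
    obtain N where "\<And>x. x \<in> B \<Longrightarrow> \<bar>f x\<bar> \<le> N"
      using f by (auto simp: bounded_functions_def)
    then have "K * N - 0 \<in> V f"
      by (intro V_I[OF zero]) force
    then show ?thesis by auto
  qed
  have P_le: "P f \<le> v" if "f \<in> ?S" "v \<in> V f" for f v
    unfolding P_def using that V_bdd by (intro cInf_lower)
  have P_ge: "z \<le> P f" if "f \<in> ?S" "\<And>v. v \<in> V f \<Longrightarrow> z \<le> v" for f z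
    unfolding P_def using that V_ne by (intro cInf_greatest)
  have P_add: "P (f + h) \<le> P f + P h" if S: "f \<in> ?S" "h \<in> ?S" for f h
  proof -
    have sum: "P (f + h) \<le> v + w" if vw: "v \<in> V f" "w \<in> V h" for v w
    proof -
      obtain M g b where v: "v = K * M - b" "(g, b) \<in> cone" "\<And>x. x \<in> B \<Longrightarrow> f x + g x \<le> M"
        using vw by (auto simp: V_def)
      obtain M' g' b' where w: "w = K * M' - b'" "(g', b') \<in> cone" "\<And>x. x \<in> B \<Longrightarrow> h x + g' x \<le> M'"
        using vw by (auto simp: V_def)
      have "K * (M + M') - (b + b') \<in> V (f + h)"
      proof (rule V_I[OF add[OF v(2) w(2)]])
        show "(f + h) x + (g x + g' x) \<le> M + M'" if "x \<in> B" for x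
          using v(3)[OF that] w(3)[OF that] by simp
      qed
      then show ?thesis
        using P_le[of "f + h"] S by (fastforce simp: v w algebra_simps)
    qed
    have "P (f + h) - v \<le> P h" if "v \<in> V f" for v
    proof (rule P_ge[OF S(2)])
      show "P (f + h) - v \<le> w" if "w \<in> V h" for w
        using sum[OF \<open>v \<in> V f\<close> that] by simp
    qed
    then have "P (f + h) - P h \<le> v" if "v \<in> V f" for v
      using that by (simp add: diff_le_eq add.commute)
    then have "P (f + h) - P h \<le> P f"
      using S by (intro P_ge)
    then show ?thesis by simp
  qed
  have P_scale_le: "P (?sc c f) \<le> c * P f" if S: "f \<in> ?S" and c: "0 < c" for c f
  proof -
    have "P (?sc c f) / c \<le> v" if v: "v \<in> V f" for v
    proof -
      obtain M g b where v: "v = K * M - b" "(g, b) \<in> cone" "\<And>x. x \<in> B \<Longrightarrow> f x + g x \<le> M"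
        using v by (auto simp: V_def)
      have "K * (c * M) - c * b \<in> V (?sc c f)"
      proof (rule V_I[OF scale[OF v(2) c]])
        show "c * f x + c * g x \<le> c * M" if "x \<in> B" for x
          using mult_left_mono[OF v(3)[OF that], of c] c by (simp add: algebra_simps)
      qed
      then have "P (?sc c f) \<le> K * (c * M) - c * b"
        using S by (intro P_le) auto
      then show ?thesis
        using c by (simp add: v field_simps)
    qed
    then have "P (?sc c f) / c \<le> P f"
      using S by (intro P_ge)
    then show ?thesis using c by (simp add: field_simps)
  qed
  have P_0: "P 0 = 0"
  proof (rule antisym)
    have "K * 0 - 0 \<in> V 0"
      by (rule V_I[OF zero]) simp
    then show "P 0 \<le> 0"
      using P_le[of 0 0] by simp
    have "0 \<le> v" if "v \<in> V 0" for v
      using that dominated by (auto simp: V_def)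
    then show "0 \<le> P 0" by (intro P_ge) auto
  qed
  have P_scale: "P (?sc c f) = c * P f" if S: "f \<in> ?S" and c: "0 \<le> c" for c f
  proof (cases "c = 0")
    case False
    then have c: "c > 0" using c by simp
    have "P f \<le> inverse c * P (?sc c f)"
      using P_scale_le[of "?sc c f" "inverse c"] S_closed(3)[OF S, of c] c
      by (simp add: mult.assoc [symmetric])
    then have "c * P f \<le> P (?sc c f)"
      using c by (simp add: field_simps)
    then show ?thesis using P_scale_le[OF S c] by simp
  qed (use P_0 in \<open>simp add: zero_fun_def\<close>)
  have "sublinear_on ?sc ?S P"
    using P_add P_scale by (auto simp: sublinear_on_def)
  then obtain L where L: "\<And>f g. f \<in> ?S \<Longrightarrow> g \<in> ?S \<Longrightarrow> L (f + g) = L f + L g"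
    "\<And>c f. f \<in> ?S \<Longrightarrow> L (?sc c f) = c * L f" "\<And>f. f \<in> ?S \<Longrightarrow> L f \<le> P f"
    using sublinear_dominates_linear by metis
  have L_le: "L f \<le> K * M" if f: "f \<in> ?S" and M: "\<And>x. x \<in> B \<Longrightarrow> f x \<le> M" for f M
  proof -
    have "K * M - 0 \<in> V f"
      by (rule V_I[OF zero]) (use M in simp)
    then show ?thesis
      using L(3)[OF f] P_le[OF f] by fastforce
  qed
  show ?thesis
  proof (rule that)
    show "dominated_functional B K L"
      unfolding dominated_functional_def
    proof (intro conjI ballI allI impI)
      show "L (\<lambda>x. f x + g x) = L f + L g" if "f \<in> ?S" "g \<in> ?S" for f g
        using L(1)[OF that] by (simp add: plus_fun_def)
      show "L (\<lambda>x. c * f x) = c * L f" if "f \<in> ?S" for c f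
        using L(2)[OF that] .
      show "L f \<le> K * M" if "f \<in> ?S" "\<forall>x\<in>B. f x \<le> M" for f M
        using that by (intro L_le) auto
    qed
    show "b \<le> L g" if gb: "(g, b) \<in> cone" for g b
    proof -
      have g: "g \<in> ?S" using bounded[OF gb] .
      have "K * 0 - b \<in> V (?sc (-1) g)"
        by (rule V_I[OF gb]) simp
      then have "P (?sc (-1) g) \<le> - b"
        using P_le[OF S_closed(3)[OF g]] by fastforce
      then show ?thesis
        using L(3)[OF S_closed(3)[OF g, of "-1"]] L(2)[OF g, of "-1"] by simp
    qed
  qed
qed

section \<open>Smoothness of even powers of the norm\<close>

text \<open>
  With \<open>A = (norm a)\<^sup>2\<close>, \<open>B = (norm b)\<^sup>2\<close> and \<open>v = 2 t (a \<bullet> b)\<close>, the numbers \<open>u \<plusminus> v\<close> are the squared norms of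
  \<open>a \<plusminus> t b\<close>. The sum and the difference of their \<open>m\<close>-th powers are estimated together, since each
  one enters the recursion of the other; the difference is of first order in \<open>t\<close>, and it is
  multiplied by \<open>v\<close>, which is of first order too.
\<close>

lemma even_power_smoothness_aux:
  fixes A B u v t :: real and m :: nat
  assumes A: "0 \<le> A" and B: "0 \<le> B" and t: "0 \<le> t" "t \<le> 1"
    and u: "u = A + t\<^sup>2 * B" and v: "\<bar>v\<bar> \<le> t * (A + B)"
  shows "(u + v) ^ m + (u - v) ^ m \<le> 2 * A ^ m + 4 * 2 ^ m * t\<^sup>2 * (A + B) ^ m
    \<and> \<bar>(u + v) ^ m - (u - v) ^ m\<bar> \<le> 2 * 2 ^ m * t * (A + B) ^ m"
proof (induction m)
  case 0
  then show ?case using t by simp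
next
  case (Suc m)
  define d where "d = (u + v) ^ m - (u - v) ^ m"
  define s where "s = (u + v) ^ m + (u - v) ^ m"
  define S where "S = (A + B) ^ m"
  have t2: "t\<^sup>2 \<le> 1" using t by (simp add: power_le_one)
  have S0: "0 \<le> S" and AB: "0 \<le> A + B" using A B by (simp_all add: S_def)
  have u0: "0 \<le> u" and u_le: "u \<le> A + B"
    using A B t2 mult_right_mono[OF t2 B] by (simp_all add: u)
  have "\<bar>v\<bar> \<le> A + B"
    using v mult_right_mono[OF t(2) AB] by simp
  then have pm: "\<bar>u + v\<bar> \<le> 2 * (A + B)" "\<bar>u - v\<bar> \<le> 2 * (A + B)"
    using u0 u_le by (simp_all add: abs_le_iff)
  have s_abs: "\<bar>s\<bar> \<le> 2 * 2 ^ m * S"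
  proof -
    have "\<bar>u + v\<bar> ^ m \<le> (2 * (A + B)) ^ m" "\<bar>u - v\<bar> ^ m \<le> (2 * (A + B)) ^ m"
      by (intro power_mono pm; simp)+
    moreover have "\<bar>s\<bar> \<le> \<bar>u + v\<bar> ^ m + \<bar>u - v\<bar> ^ m"
      unfolding s_def by (metis abs_triangle_ineq power_abs)
    ultimately show ?thesis
      unfolding S_def power_mult_distrib by linarith
  qed
  have IH: "s \<le> 2 * A ^ m + 4 * 2 ^ m * t\<^sup>2 * S" "\<bar>d\<bar> \<le> 2 * 2 ^ m * t * S"
    using Suc by (simp_all add: s_def d_def S_def)
  have step: "(u + v) ^ Suc m + (u - v) ^ Suc m = u * s + v * d"
    "(u + v) ^ Suc m - (u - v) ^ Suc m = u * d + v * s"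
    by (simp_all add: s_def d_def algebra_simps)
  have vd: "v * d \<le> (t * (A + B)) * (2 * 2 ^ m * t * S)"
  proof -
    have "v * d \<le> \<bar>v\<bar> * \<bar>d\<bar>" by (metis abs_ge_self abs_mult)
    also have "\<dots> \<le> (t * (A + B)) * (2 * 2 ^ m * t * S)"
      using v IH t AB by (intro mult_mono) auto
    finally show ?thesis .
  qed
  have us: "u * s \<le> 2 * A ^ Suc m + 2 * t\<^sup>2 * ((A + B) * S) + (A + B) * (4 * 2 ^ m * t\<^sup>2 * S)"
  proof -
    have "u * s \<le> u * (2 * A ^ m + 4 * 2 ^ m * t\<^sup>2 * S)"
      using IH u0 by (intro mult_left_mono)
    also have "\<dots> = 2 * A ^ Suc m + 2 * t\<^sup>2 * (B * A ^ m) + u * (4 * 2 ^ m * t\<^sup>2 * S)"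
      by (simp add: u algebra_simps)
    also have "\<dots> \<le> 2 * A ^ Suc m + 2 * t\<^sup>2 * ((A + B) * S) + (A + B) * (4 * 2 ^ m * t\<^sup>2 * S)"
      using A B S0 u_le unfolding S_def
      by (intro add_mono mult_left_mono mult_right_mono mult_mono power_mono) auto
    finally show ?thesis .
  qed
  have two: "2 * (t\<^sup>2 * ((A + B) * S)) \<le> 2 * 2 ^ m * (t\<^sup>2 * ((A + B) * S))"
    using AB S0 by (intro mult_right_mono) auto
  have first: "u * s + v * d \<le> 2 * A ^ Suc m + 8 * 2 ^ m * (t\<^sup>2 * ((A + B) * S))"
    using us vd two by (simp add: power2_eq_square algebra_simps)
  have second: "\<bar>u * d + v * s\<bar> \<le> 4 * 2 ^ m * (t * ((A + B) * S))"
  proof -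
    have "\<bar>u * d + v * s\<bar> \<le> \<bar>u\<bar> * \<bar>d\<bar> + \<bar>v\<bar> * \<bar>s\<bar>"
      by (metis abs_mult abs_triangle_ineq)
    also have "\<dots> \<le> (A + B) * (2 * 2 ^ m * t * S) + (t * (A + B)) * (2 * 2 ^ m * S)"
      using u_le u0 v IH s_abs AB S0 t by (intro add_mono mult_mono) auto
    finally show ?thesis by (simp add: algebra_simps)
  qed
  have eqs: "4 * 2 ^ Suc m * t\<^sup>2 * (A + B) ^ Suc m = 8 * 2 ^ m * (t\<^sup>2 * ((A + B) * S))"
    "2 * 2 ^ Suc m * t * (A + B) ^ Suc m = 4 * 2 ^ m * (t * ((A + B) * S))"
    by (simp_all add: S_def)
  show ?case
    unfolding step eqs by (intro conjI first second)
qed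

text \<open>
  The function \<open>t \<mapsto> norm (a + t b) ^ (2 m)\<close> is a polynomial, so its symmetric second difference is
  quadratic in \<open>t\<close>. Both sides are combinations of \<open>2 m\<close>-th powers of norms, so the inequality survives
  integration: this is the uniform smoothness of \<open>L\<^sub>p\<close> for even \<open>p\<close>.
\<close>

lemma norm_even_power_smoothness:
  fixes a b :: "'k::real_inner"
  assumes t: "0 \<le> t" "t \<le> 1"
  shows "norm (a + t *\<^sub>R b) ^ (2 * m) + norm (a - t *\<^sub>R b) ^ (2 * m)
    \<le> 2 * norm a ^ (2 * m) + 4 * 4 ^ m * t\<^sup>2 * (norm a ^ (2 * m) + norm b ^ (2 * m))"
proof -
  define A B u v where "A = (norm a)\<^sup>2" and "B = (norm b)\<^sup>2"
    and "u = A + t\<^sup>2 * B" and "v = 2 * t * (a \<bullet> b)"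
  have AB: "0 \<le> A" "0 \<le> B" by (simp_all add: A_def B_def)
  have "\<bar>v\<bar> = t * (2 * \<bar>a \<bullet> b\<bar>)"
    using t by (simp add: v_def abs_mult)
  also have "\<dots> \<le> t * (A + B)"
  proof (rule mult_left_mono[OF _ t(1)])
    have "\<bar>a \<bullet> b\<bar> \<le> norm a * norm b" by (rule Cauchy_Schwarz_ineq2)
    moreover have "2 * (norm a * norm b) \<le> A + B"
      using sum_squares_bound[of "norm a" "norm b"] by (simp add: A_def B_def mult.assoc)
    ultimately show "2 * \<bar>a \<bullet> b\<bar> \<le> A + B" by linarith
  qed
  finally have v: "\<bar>v\<bar> \<le> t * (A + B)" .
  have pm: "(norm (a + t *\<^sub>R b))\<^sup>2 = u + v" "(norm (a - t *\<^sub>R b))\<^sup>2 = u - v"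
    unfolding A_def B_def u_def v_def power2_norm_eq_inner
    by (simp_all add: inner_left_distrib inner_right_distrib inner_diff_left inner_diff_right
        inner_commute power2_eq_square algebra_simps)
  have "(A + B) ^ m \<le> (2 * max A B) ^ m"
    using AB by (intro power_mono) auto
  also have "\<dots> \<le> 2 ^ m * (A ^ m + B ^ m)"
    using AB by (auto simp: power_mult_distrib max_def)
  finally have "4 * 2 ^ m * t\<^sup>2 * (A + B) ^ m \<le> 4 * 2 ^ m * t\<^sup>2 * (2 ^ m * (A ^ m + B ^ m))"
    by (intro mult_left_mono) auto
  also have "\<dots> = 4 * 4 ^ m * t\<^sup>2 * (A ^ m + B ^ m)"
    by (simp add: power_mult_distrib[symmetric])
  finally show ?thesis
    using even_power_smoothness_aux[OF AB t u_def v, of m]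
    by (simp add: power_mult pm flip: A_def B_def)
qed

section \<open>Smooth seminorms on a dual space and their uniformly convex polars\<close>

text \<open>
  The members of small diameter meet each other, so points chosen in them form a Cauchy sequence.
  Every other member meets them too and therefore contains points close to the limit.
\<close>

lemma complete_pairwise_meeting:
  fixes \<K> :: "'a::complete_space set set"
  assumes meet: "\<And>K L. K \<in> \<K> \<Longrightarrow> L \<in> \<K> \<Longrightarrow> K \<inter> L \<noteq> {}"
    and small: "\<And>e. 0 < e \<Longrightarrow> \<exists>K\<in>\<K>. \<forall>x\<in>K. \<forall>y\<in>K. dist x y \<le> e"
  shows "\<exists>x. \<forall>K\<in>\<K>. x \<in> closure K"
proof -
  define \<epsilon> where "\<epsilon> = (\<lambda>n. inverse (real (Suc n)))"
  have \<epsilon>: "\<epsilon> \<longlonglongrightarrow> 0" "0 < \<epsilon> n" for n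
    using LIMSEQ_inverse_real_of_nat by (simp_all add: \<epsilon>_def del: of_nat_Suc)
  obtain K where K: "K n \<in> \<K>" "\<And>x y. x \<in> K n \<Longrightarrow> y \<in> K n \<Longrightarrow> dist x y \<le> \<epsilon> n" for n
    using small[OF \<epsilon>(2)] by metis
  obtain x where x: "x n \<in> K n" for n
  proof -
    have "\<exists>x. x \<in> K n" for n
      using meet[OF K(1) K(1), of n n] by auto
    then show ?thesis using that by metis
  qed
  have close: "\<exists>z\<in>L. dist (x n) z \<le> \<epsilon> n" if "L \<in> \<K>" for L n
    using meet[OF K(1) that] K(2)[OF x] by blast
  have "Cauchy x"
  proof (rule metric_CauchyI)
    fix e :: real assume "0 < e"
    then obtain N where N: "\<And>n. n \<ge> N \<Longrightarrow> \<epsilon> n < e / 2"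
      using order_tendstoD(2)[OF \<epsilon>(1), of "e / 2"] by (auto simp: eventually_sequentially)
    have "dist (x m) (x n) < e" if "m \<ge> N" "n \<ge> N" for m n
    proof -
      obtain z where "z \<in> K n" "dist (x m) z \<le> \<epsilon> m"
        using close[OF K(1)] by blast
      then have "dist (x m) (x n) \<le> \<epsilon> m + \<epsilon> n"
        using K(2)[OF _ x] by (metis add_mono dist_triangle order_trans)
      then show ?thesis using N[OF that(1)] N[OF that(2)] by simp
    qed
    then show "\<exists>N. \<forall>m\<ge>N. \<forall>n\<ge>N. dist (x m) (x n) < e" by blast
  qed
  then obtain l where l: "x \<longlonglongrightarrow> l"
    by (auto simp: Cauchy_convergent_iff convergent_def)
  have "l \<in> closure L" if "L \<in> \<K>" for L
  proof -
    obtain z where z: "z n \<in> L" "dist (x n) (z n) \<le> \<epsilon> n" for n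
      using close[OF \<open>L \<in> \<K>\<close>] by metis
    have "(\<lambda>n. \<epsilon> n + dist (x n) l) \<longlonglongrightarrow> 0 + 0"
      by (intro tendsto_add \<epsilon>(1) tendsto_dist_iff[THEN iffD1] l)
    then have lim: "(\<lambda>n. \<epsilon> n + dist (x n) l) \<longlonglongrightarrow> 0"
      by simp
    have le: "\<forall>\<^sub>F n in sequentially. dist (z n) l \<le> \<epsilon> n + dist (x n) l"
    proof (intro always_eventually allI)
      fix n show "dist (z n) l \<le> \<epsilon> n + dist (x n) l"
        using dist_triangle3[of "z n" l "x n"] z(2)[of n] by linarith
    qed
    have "(\<lambda>n. dist (z n) l) \<longlonglongrightarrow> 0"
      by (rule tendsto_sandwich[OF _ le tendsto_const lim]) simp
    then have "z \<longlonglongrightarrow> l"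
      by (rule tendsto_dist_iff[THEN iffD2])
    then show "l \<in> closure L"
      using z by (auto simp: closure_sequential)
  qed
  then show ?thesis by blast
qed

text \<open>
  The function \<open>G\<close> stands for the \<open>n\<close>-th power of a seminorm on the space \<open>D\<close> of functionals;
  \<open>G_smooth\<close> expresses that this seminorm is uniformly smooth with a modulus of power type 2. By \<open>norming\<close>, the norm of the underlying space is at most
  \<open>\<kappa>\<close> times the norm dual to it.
\<close>

locale smooth_gauge =
  fixes D :: "('a::banach \<Rightarrow> 'k::real_normed_field) set" and G :: "('a \<Rightarrow> 'k) \<Rightarrow> real"
    and n :: nat and c \<kappa> :: real
  assumes D_linear: "f \<in> D \<Longrightarrow> bounded_linear f"
    and D_add: "f \<in> D \<Longrightarrow> g \<in> D \<Longrightarrow> (\<lambda>x. f x + g x) \<in> D"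
    and D_scale: "f \<in> D \<Longrightarrow> (\<lambda>x. a * f x) \<in> D"
    and G_nonneg: "f \<in> D \<Longrightarrow> 0 \<le> G f"
    and G_scale: "f \<in> D \<Longrightarrow> G (\<lambda>x. a * f x) = norm a ^ n * G f"
    and G_smooth: "f \<in> D \<Longrightarrow> g \<in> D \<Longrightarrow> 0 \<le> t \<Longrightarrow> t \<le> 1 \<Longrightarrow>
      G (\<lambda>x. f x + of_real t * g x) + G (\<lambda>x. f x - of_real t * g x)
        \<le> 2 * G f + c * t\<^sup>2 * (G f + G g)"
    and n: "2 \<le> n" and c: "0 \<le> c" and \<kappa>: "0 \<le> \<kappa>"
    and norming: "\<exists>f\<in>D. G f \<le> 1 \<and> norm x \<le> \<kappa> * norm (f x)"
begin

text \<open>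
  The ball of radius \<open>r\<close>, which is empty for \<open>r < 0\<close>, in the norm dual to the \<open>n\<close>-th root of \<open>G\<close>.
\<close>

definition polar_ball :: "real \<Rightarrow> 'a set" where
  "polar_ball r = {x. \<forall>f\<in>D. G f \<le> 1 \<longrightarrow> norm (f x) \<le> r}"

lemma polar_ball_mono: "r \<le> r' \<Longrightarrow> polar_ball r \<subseteq> polar_ball r'"
  by (force simp: polar_ball_def)

lemma polar_ball_nonneg: "x \<in> polar_ball r \<Longrightarrow> 0 \<le> r"
  using norming[of x] unfolding polar_ball_def by (force intro: order_trans[OF norm_ge_zero])

lemma polar_ball_bound:
  assumes x: "x \<in> polar_ball r" and f: "f \<in> D" and a: "0 < a" "G f \<le> a ^ n"
  shows "norm (f x) \<le> r * a"
proof -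
  have "G (\<lambda>x. of_real (inverse a) * f x) = inverse a ^ n * G f"
    using G_scale[OF f, of "of_real (inverse a)"] a(1)
    by (simp add: norm_inverse)
  also have "\<dots> \<le> 1"
    using a by (simp add: field_simps power_divide)
  finally have "norm (of_real (inverse a) * f x) \<le> r"
    using x D_scale[OF f] by (auto simp: polar_ball_def)
  then show ?thesis
    using a(1) by (simp add: norm_mult norm_divide field_simps)
qed

text \<open>
  The tangent bound \<open>y\<^bsup>1/n\<^esup> \<le> 1 + (y - 1) / n\<close>, in the form of Bernoulli's inequality, takes the place of
  the root of \<open>G f\<close>; it is positive even where \<open>G f = 0\<close>.
\<close>

lemma polar_ball_bound_tangent:
  assumes "x \<in> polar_ball r" "f \<in> D"
  shows "norm (f x) \<le> r * (1 + (G f - 1) / n)"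
proof (rule polar_ball_bound[OF assms])
  have "- 1 / real n \<le> (G f - 1) / n"
    using G_nonneg[OF assms(2)] by (intro divide_right_mono) auto
  moreover have "1 / real n < 1"
    using n by simp
  ultimately have *: "- 1 < (G f - 1) / n"
    by linarith
  then show "0 < 1 + (G f - 1) / n" by linarith
  have "1 + real n * ((G f - 1) / n) \<le> (1 + (G f - 1) / n) ^ n"
    by (rule Bernoulli_inequality) (use * in linarith)
  then show "G f \<le> (1 + (G f - 1) / n) ^ n"
    using n by simp
qed

lemma rotate:
  assumes "f \<in> D"
  obtains f' where "f' \<in> D" "G f' = G f" "f' z = of_real (norm (f z))"
proof (cases "f z = 0")
  case True
  then show ?thesis using that[OF assms] by simp
next
  case False
  show ?thesis
  proof (rule that)
    show "(\<lambda>x. (of_real (norm (f z)) / f z) * f x) \<in> D"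
      using D_scale[OF assms] .
    show "G (\<lambda>x. (of_real (norm (f z)) / f z) * f x) = G f"
      using False by (simp only: G_scale[OF assms]) (simp add: norm_divide)
    show "(of_real (norm (f z)) / f z) * f z = of_real (norm (f z))"
      using False by simp
  qed
qed

text \<open>
  Duality turns smoothness into convexity: \<open>(f + t g) x + (f - t g) y = f (x + y) + t g (x - y)\<close>, and
  the \<open>n\<close>-th roots of \<open>G (f \<plusminus> t g)\<close> sum to at most \<open>2 + c t\<^sup>2\<close>. If \<open>f (x + y)\<close> is almost \<open>2 r\<close>, then
  \<open>g (x - y)\<close> is small, uniformly in \<open>g\<close>.
\<close>

lemma polar_ball_uniformly_convex:
  assumes f: "f \<in> D" "G f \<le> 1" and g: "g \<in> D" "G g \<le> 1"
    and t: "0 \<le> t" "t \<le> 1" and x: "x \<in> polar_ball r" and y: "y \<in> polar_ball r"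
  shows "norm (f (x + y)) + t * norm (g (x - y)) \<le> r * (2 + c * t\<^sup>2)"
proof -
  obtain f' where f': "f' \<in> D" "G f' \<le> 1" "f' (x + y) = of_real (norm (f (x + y)))"
    using rotate[OF f(1), of "x + y"] f(2) by metis
  obtain g' where g': "g' \<in> D" "G g' \<le> 1" "g' (x - y) = of_real (norm (g (x - y)))"
    using rotate[OF g(1), of "x - y"] g(2) by metis
  define p q where "p x = f' x + of_real t * g' x" and "q x = f' x - of_real t * g' x" for x
  have p: "p \<in> D" unfolding p_def
    using D_add[OF f'(1) D_scale[OF g'(1)]] by simp
  have q: "q \<in> D" unfolding q_def
    using D_add[OF f'(1) D_scale[OF g'(1), of "- of_real t"]] by simp
  have pq: "G p + G q \<le> 2 + c * t\<^sup>2 * 2"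
  proof -
    have "G p + G q \<le> 2 * G f' + c * t\<^sup>2 * (G f' + G g')"
      unfolding p_def q_def by (rule G_smooth[OF f'(1) g'(1) t])
    also have "\<dots> \<le> 2 * 1 + c * t\<^sup>2 * 2"
      using f'(2) g'(2) c by (intro add_mono mult_left_mono) auto
    finally show ?thesis by simp
  qed
  have "p x + q y = (f' x + f' y) + of_real t * (g' x - g' y)"
    by (simp add: p_def q_def algebra_simps)
  also have "\<dots> = f' (x + y) + of_real t * g' (x - y)"
    using linear_add[OF bounded_linear.linear[OF D_linear[OF f'(1)]]]
      linear_diff[OF bounded_linear.linear[OF D_linear[OF g'(1)]]]
    by simp
  also have "\<dots> = of_real (norm (f (x + y)) + t * norm (g (x - y)))"
    by (simp add: f' g')
  finally have "norm (f (x + y)) + t * norm (g (x - y)) = norm (p x + q y)"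
    using t by (simp only: norm_of_real) simp
  also have "\<dots> \<le> norm (p x) + norm (q y)"
    by (rule norm_triangle_ineq)
  also have "\<dots> \<le> r * (1 + (G p - 1) / n) + r * (1 + (G q - 1) / n)"
    by (intro add_mono polar_ball_bound_tangent x y p q)
  also have "\<dots> = r * (2 + (G p + G q - 2) / n)"
    by (simp add: algebra_simps add_divide_distrib diff_divide_distrib)
  also have "\<dots> \<le> r * (2 + c * t\<^sup>2)"
  proof (intro mult_left_mono add_left_mono polar_ball_nonneg[OF x])
    have "(G p + G q - 2) / n \<le> (c * t\<^sup>2 * 2) / n"
      using pq by (intro divide_right_mono) auto
    also have "\<dots> \<le> (c * t\<^sup>2 * 2) / 2"
      using n c by (intro divide_left_mono) auto
    finally show "(G p + G q - 2) / n \<le> c * t\<^sup>2" by simp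
  qed
  finally show ?thesis .
qed

definition near :: "(('a \<Rightarrow> 'k) \<Rightarrow> 'k) \<Rightarrow> ('a \<Rightarrow> 'k) set \<Rightarrow> real \<Rightarrow> 'a set" where
  "near \<eta> F e = {x. \<forall>f\<in>F. norm (f x - \<eta> f) < e}"

lemma near_midpoint:
  assumes "x \<in> near \<eta> F e" "y \<in> near \<eta> F e" "F \<subseteq> D"
  shows "(1 / 2) *\<^sub>R (x + y) \<in> near \<eta> F e"
  unfolding near_def
proof (intro CollectI ballI)
  fix f assume f: "f \<in> F"
  have lin: "linear f"
    using f assms(3) D_linear by (blast intro: bounded_linear.linear)
  have half: "norm ((1 / 2) *\<^sub>R (u + v)) \<le> (norm u + norm v) / 2" for u v :: 'k
    using norm_triangle_ineq[of u v] by simp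
  have "f ((1 / 2) *\<^sub>R (x + y)) - \<eta> f = (1 / 2) *\<^sub>R ((f x - \<eta> f) + (f y - \<eta> f))"
    by (simp add: linear_scale[OF lin] linear_add[OF lin] scaleR_conv_of_real field_simps)
  also have "norm \<dots> \<le> (norm (f x - \<eta> f) + norm (f y - \<eta> f)) / 2"
    by (rule half)
  also have "\<dots> < e"
    using assms(1,2) f unfolding near_def by force
  finally show "norm (f ((1 / 2) *\<^sub>R (x + y)) - \<eta> f) < e" .
qed

text \<open>
  Let \<open>d\<close> be the least radius such that the polar balls of larger radius meet every pointwise
  neighbourhood of \<open>\<eta>\<close>. Some neighbourhood misses the ball of radius \<open>d - \<delta>\<close>, so the midpoint of any two
  of its points in the ball of radius \<open>d + \<delta>\<close> lies outside the smaller ball, and uniform convexity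
  makes the two points close. Hence these sets shrink to a point, which represents \<open>\<eta>\<close>.
  This is the argument of Milman and Pettis, except that \<open>d\<close> replaces the norm of \<open>\<eta>\<close>, so that
  no points of norm close to that of \<open>\<eta>\<close> have to be known in advance.
\<close>

theorem pointwise_limit_is_evaluation:
  assumes R: "\<And>F e. finite F \<Longrightarrow> F \<subseteq> D \<Longrightarrow> 0 < e \<Longrightarrow> near \<eta> F e \<inter> polar_ball R \<noteq> {}"
  obtains x where "\<And>f. f \<in> D \<Longrightarrow> f x = \<eta> f"
proof -
  define S where "S = {r. \<forall>F e. finite F \<longrightarrow> F \<subseteq> D \<longrightarrow> 0 < e \<longrightarrow> near \<eta> F e \<inter> polar_ball r \<noteq> {}}"
  define d where "d = Inf S"
  have "R \<in> S" using R by (auto simp: S_def)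
  have S_nonneg: "0 \<le> r" if "r \<in> S" for r
  proof -
    have "near \<eta> F e \<inter> polar_ball r \<noteq> {}" if "finite F" "F \<subseteq> D" "0 < e" for F e
      using \<open>r \<in> S\<close> that by (simp add: S_def)
    then have "near \<eta> {} 1 \<inter> polar_ball r \<noteq> {}"
      by simp
    then show ?thesis by (auto dest: polar_ball_nonneg)
  qed
  have bdd: "bdd_below S"
    by (rule bdd_belowI[of _ 0]) (rule S_nonneg)
  have d0: "0 \<le> d"
    unfolding d_def using S_nonneg \<open>R \<in> S\<close> by (intro cInf_greatest) auto
  have above: "near \<eta> F e \<inter> polar_ball r \<noteq> {}" if "d < r" "finite F" "F \<subseteq> D" "0 < e" for r F e
  proof -
    obtain r' where r': "r' \<in> S" "r' < r"
      using cInf_lessD[of S r] \<open>d < r\<close> \<open>R \<in> S\<close> unfolding d_def by blast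
    have "near \<eta> F e \<inter> polar_ball r' \<noteq> {}"
      using r' that by (auto simp: S_def)
    then show ?thesis
      using polar_ball_mono[of r' r] r' by auto
  qed
  have below: "\<exists>F e. finite F \<and> F \<subseteq> D \<and> 0 < e \<and> near \<eta> F e \<inter> polar_ball r = {}" if "r < d" for r
  proof -
    have "r \<notin> S" using that bdd unfolding d_def by (auto dest: cInf_lower)
    then show ?thesis by (auto simp: S_def)
  qed
  define \<K> where "\<K> = {near \<eta> F e \<inter> polar_ball r | F e r. finite F \<and> F \<subseteq> D \<and> 0 < e \<and> d < r}"
  have \<K>_I: "near \<eta> F e \<inter> polar_ball r \<in> \<K>" if "finite F" "F \<subseteq> D" "0 < e" "d < r" for F e r
    using that by (auto simp: \<K>_def)
  have "\<exists>x. \<forall>K\<in>\<K>. x \<in> closure K"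
  proof (rule complete_pairwise_meeting)
    fix K L assume "K \<in> \<K>" "L \<in> \<K>"
    then obtain F e r F' e' r' where K: "K = near \<eta> F e \<inter> polar_ball r" "finite F" "F \<subseteq> D" "0 < e" "d < r"
      and L: "L = near \<eta> F' e' \<inter> polar_ball r'" "finite F'" "F' \<subseteq> D" "0 < e'" "d < r'"
      unfolding \<K>_def by blast
    have "near \<eta> (F \<union> F') (min e e') \<inter> polar_ball (min r r') \<noteq> {}"
      using K L by (intro above) auto
    moreover have "near \<eta> (F \<union> F') (min e e') \<subseteq> near \<eta> F e \<inter> near \<eta> F' e'"
      by (auto simp: near_def)
    moreover have "polar_ball (min r r') \<subseteq> polar_ball r \<inter> polar_ball r'"
      using polar_ball_mono by simp
    ultimately show "K \<inter> L \<noteq> {}" unfolding K L by blast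
  next
    fix e :: real assume e: "0 < e"
    \<comment> \<open>First \<open>t\<close> makes the error \<open>\<kappa> c (d + 1) t\<close> at most \<open>e / 2\<close>, then \<open>\<delta>\<close> does the same for \<open>4 \<kappa> \<delta> / t\<close>.\<close>
    define M where "M = \<kappa> * c * (d + 1) + 1"
    have M: "0 < M" using \<kappa> c d0 by (simp add: M_def add_nonneg_pos)
    define t where "t = min 1 (e / (2 * M))"
    have t: "0 < t" "t \<le> 1" "t * M \<le> e / 2"
      using e M by (auto simp: t_def min_def field_simps)
    define \<delta> where "\<delta> = min 1 (e * t / (8 * (\<kappa> + 1)))"
    have "\<delta> \<le> e * t / (8 * (\<kappa> + 1))"
      by (simp add: \<delta>_def)
    then have \<delta>_le: "8 * (\<kappa> + 1) * \<delta> \<le> e * t"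
      using \<kappa> by (simp add: pos_le_divide_eq mult.commute)
    have \<delta>: "0 < \<delta>" "\<delta> \<le> 1"
      using e t \<kappa> by (simp_all add: \<delta>_def)
    obtain F e0 where F: "finite F" "F \<subseteq> D" "0 < e0" "near \<eta> F e0 \<inter> polar_ball (d - \<delta>) = {}"
      using below[of "d - \<delta>"] \<delta> by auto
    have "dist x y \<le> e" if xy: "x \<in> near \<eta> F e0 \<inter> polar_ball (d + \<delta>)"
      "y \<in> near \<eta> F e0 \<inter> polar_ball (d + \<delta>)" for x y
    proof -
      have "(1 / 2) *\<^sub>R (x + y) \<notin> polar_ball (d - \<delta>)"
        using near_midpoint[of x \<eta> F e0 y] xy F by blast
      then obtain f where f: "f \<in> D" "G f \<le> 1" "d - \<delta> < norm (f ((1 / 2) *\<^sub>R (x + y)))"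
        by (auto simp: polar_ball_def not_le)
      have f_xy: "2 * (d - \<delta>) < norm (f (x + y))"
        using f(3) linear_scale[OF bounded_linear.linear[OF D_linear[OF f(1)]], of "1/2" "x + y"]
        by simp
      obtain g where g: "g \<in> D" "G g \<le> 1" "norm (x - y) \<le> \<kappa> * norm (g (x - y))"
        using norming by blast
      let ?N = "norm (g (x - y))"
      have "norm (f (x + y)) + t * ?N \<le> (d + \<delta>) * (2 + c * t\<^sup>2)"
        using xy t by (intro polar_ball_uniformly_convex f g) auto
      then have "t * ?N \<le> 4 * \<delta> + (d + \<delta>) * (c * t\<^sup>2)"
        using f_xy by (simp add: algebra_simps)
      also have "\<dots> \<le> 4 * \<delta> + (d + 1) * (c * t\<^sup>2)"
        using \<delta> c by (intro add_left_mono mult_right_mono) auto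
      finally have "\<kappa> * (t * ?N) \<le> \<kappa> * (4 * \<delta> + (d + 1) * (c * t\<^sup>2))"
        using \<kappa> by (rule mult_left_mono)
      also have "\<dots> = 4 * \<kappa> * \<delta> + t * (t * (M - 1))"
        by (simp add: M_def power2_eq_square algebra_simps)
      also have "\<dots> \<le> t * e / 2 + t * (e / 2)"
      proof (intro add_mono mult_left_mono)
        show "4 * \<kappa> * \<delta> \<le> t * e / 2" using \<delta> \<delta>_le by (simp add: algebra_simps)
        show "t * (M - 1) \<le> e / 2" using t by (simp add: algebra_simps)
      qed (use t in auto)
      finally have "t * (\<kappa> * ?N) \<le> t * e" by (simp add: algebra_simps)
      then have "\<kappa> * ?N \<le> e" using t by simp
      then show ?thesis using g(3) by (simp add: dist_norm)
    qed
    moreover have "near \<eta> F e0 \<inter> polar_ball (d + \<delta>) \<in> \<K>"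
      using F \<delta> by (intro \<K>_I) auto
    ultimately show "\<exists>K\<in>\<K>. \<forall>x\<in>K. \<forall>y\<in>K. dist x y \<le> e" by blast
  qed
  then obtain x where x: "\<And>K. K \<in> \<K> \<Longrightarrow> x \<in> closure K"
    by blast
  show ?thesis
  proof (rule that)
    fix f assume f: "f \<in> D"
    have "norm (f x - \<eta> f) \<le> e" if e: "0 < e" for e
    proof -
      have "continuous_on UNIV f"
        using D_linear[OF f] by (rule linear_continuous_on)
      then have "closed {x. norm (f x - \<eta> f) \<le> e}"
        by (intro closed_Collect_le continuous_on_norm continuous_on_diff continuous_on_const)
      moreover have "near \<eta> {f} e \<inter> polar_ball (d + 1) \<subseteq> {x. norm (f x - \<eta> f) \<le> e}"
        by (auto simp: near_def)
      ultimately have "closure (near \<eta> {f} e \<inter> polar_ball (d + 1)) \<subseteq> {x. norm (f x - \<eta> f) \<le> e}"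
        by (rule closure_minimal[rotated])
      moreover have "x \<in> closure (near \<eta> {f} e \<inter> polar_ball (d + 1))"
        using f e by (intro x \<K>_I) auto
      ultimately show ?thesis
        by (simp add: subset_iff)
    qed
    then have "norm (f x - \<eta> f) \<le> 0"
      by (rule dense_ge)
    then show "f x = \<eta> f" by simp
  qed
qed

end

section \<open>Weakly summable families of functionals\<close>

lemma dual_space_linear: "f \<in> dual_space s \<Longrightarrow> bounded_linear f"
  by (simp add: dual_space_def)

lemma dual_space_zero: "(\<lambda>x. 0) \<in> dual_space s"
  by (simp add: dual_space_def)

lemma dual_space_add:
  "f \<in> dual_space s \<Longrightarrow> g \<in> dual_space s \<Longrightarrow> (\<lambda>x. f x + g x) \<in> dual_space s"
  by (simp add: dual_space_def bounded_linear_add distrib_left)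

lemma dual_space_scale: "f \<in> dual_space s \<Longrightarrow> (\<lambda>x. a * f x) \<in> dual_space s"
  by (simp add: dual_space_def bounded_linear_const_mult mult.left_commute)

lemma bidual_space_zero:
  assumes "\<eta> \<in> bidual_space s"
  shows "\<eta> (\<lambda>x. 0) = 0"
proof -
  have "\<forall>c. \<forall>f\<in>dual_space s. \<eta> (\<lambda>x. c * f x) = c * \<eta> f"
    using assms by (simp add: bidual_space_def)
  from this[rule_format, OF dual_space_zero, of 0] show ?thesis
    by simp
qed

lemma bidual_space_sum_list:
  assumes \<eta>: "\<eta> \<in> bidual_space s" and L: "set L \<subseteq> dual_space s"
  shows "(\<lambda>x. \<Sum>f\<leftarrow>L. b f * f x) \<in> dual_space s \<and>
    \<eta> (\<lambda>x. \<Sum>f\<leftarrow>L. b f * f x) = (\<Sum>f\<leftarrow>L. b f * \<eta> f)"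
  using L
proof (induction L)
  case Nil
  then show ?case using bidual_space_zero[OF \<eta>] by (simp add: dual_space_zero)
next
  case (Cons f L)
  then show ?case
    using \<eta> by (simp add: bidual_space_def dual_space_add dual_space_scale)
qed

lemma onorm_le_unit_ball:
  assumes f: "bounded_linear f" and b: "\<And>x. norm x \<le> 1 \<Longrightarrow> norm (f x) \<le> b"
  shows "onorm f \<le> b"
proof (rule onorm_bound)
  show "0 \<le> b" using b[of 0] by (metis norm_ge_zero norm_zero order_trans zero_le_one)
  show "norm (f x) \<le> b * norm x" for x
  proof (cases "x = 0")
    case True
    then show ?thesis using linear_0[OF bounded_linear.linear[OF f]] by simp
  next
    case False
    have "norm (f ((1 / norm x) *\<^sub>R x)) \<le> b" using False by (intro b) simp
    then show ?thesis
      using False by (simp add: linear_scale[OF bounded_linear.linear[OF f]] field_simps)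
  qed
qed

text \<open>
  A substitute for Young's inequality with a free weight \<open>\<theta>\<close>, valid down to \<open>p = 1\<close>: the product
  \<open>z\<^bsup>p - 1\<^esup> y\<close> is at most the first summand if \<open>y \<le> \<theta> z\<close> and at most the second one otherwise.
\<close>

lemma powr_young:
  fixes y z \<theta> p :: real
  assumes y: "0 \<le> y" and z: "0 < z" and \<theta>: "0 < \<theta>" and p: "1 \<le> p"
  shows "z powr p / z * y \<le> \<theta> * z powr p + \<theta> powr (1 - p) * y powr p"
proof (cases "y \<le> \<theta> * z")
  case True
  then have "y / z \<le> \<theta>" using z by (simp add: field_simps)
  then have "z powr p * (y / z) \<le> z powr p * \<theta>" by (intro mult_left_mono) auto
  moreover have "0 \<le> \<theta> powr (1 - p) * y powr p" by simp
  moreover have "z powr p / z * y = z powr p * (y / z)" by simp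
  moreover have "z powr p * \<theta> = \<theta> * z powr p" by simp
  ultimately show ?thesis by linarith
next
  case False
  then have y: "0 < y" "z \<le> y / \<theta>" using z \<theta> by (simp_all add: field_simps)
      (smt (verit) mult_pos_pos)
  have "z powr p / z * y = z powr (p - 1) * y"
    using z by (simp add: powr_diff)
  also have "\<dots> \<le> (y / \<theta>) powr (p - 1) * y"
    using y z p by (intro mult_right_mono powr_mono2) auto
  also have "\<dots> = \<theta> powr (1 - p) * y powr p"
    using y \<theta> by (simp add: powr_divide powr_diff field_simps)
  finally have "z powr p / z * y \<le> \<theta> powr (1 - p) * y powr p" .
  moreover have "0 \<le> \<theta> * z powr p" using \<theta> by simp
  ultimately show ?thesis by linarith
qed

text \<open>
  Weak summability is tested on the bidual, but for finite families the unit ball of the space itself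
  controls it, with a factor independent of the family. The sum to be bounded, \<open>T\<close>, is the value of \<open>\<eta>\<close> at a
  combination \<open>g\<close> of the family; by Young's inequality \<open>onorm g\<close> is at most \<open>\<theta> T\<close> plus a multiple of
  \<open>M\<close>, and a small \<open>\<theta>\<close> lets \<open>T\<close> be absorbed.
\<close>

lemma bidual_weak_bound:
  fixes s :: "'k::real_normed_field \<Rightarrow> 'a::banach \<Rightarrow> 'a" and p :: real
  assumes p: "1 \<le> p" and \<eta>: "\<eta> \<in> bidual_space s"
  obtains C where "\<And>L M. set L \<subseteq> dual_space s \<Longrightarrow>
    (\<And>x. norm x \<le> 1 \<Longrightarrow> (\<Sum>f\<leftarrow>L. norm (f x) powr p) \<le> M) \<Longrightarrow>
    (\<Sum>f\<leftarrow>L. norm (\<eta> f) powr p) \<le> C * M"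
proof -
  have "\<exists>K. \<forall>f\<in>dual_space s. norm (\<eta> f) \<le> K * onorm f"
    using \<eta> by (simp add: bidual_space_def)
  then obtain K where K: "\<And>f. f \<in> dual_space s \<Longrightarrow> norm (\<eta> f) \<le> K * onorm f"
    by blast
  define H where "H = max K 1"
  define \<theta> where "\<theta> = 1 / (2 * H)"
  have H: "K \<le> H" "0 < H" by (simp_all add: H_def)
  then have \<theta>: "0 < \<theta>" "H * \<theta> = 1 / 2" by (simp_all add: \<theta>_def)
  show ?thesis
  proof (rule that)
    fix L M
    assume L: "set L \<subseteq> dual_space s"
      and M: "\<And>x. norm x \<le> 1 \<Longrightarrow> (\<Sum>f\<leftarrow>L. norm (f x) powr p) \<le> M"
    define T where "T = (\<Sum>f\<leftarrow>L. norm (\<eta> f) powr p)"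
    \<comment> \<open>The phase and the size of \<open>b f\<close> are those for which \<open>b f * \<eta> f = norm (\<eta> f) powr p\<close>.\<close>
    define b where "b f = (if \<eta> f = 0 then 0 else of_real (norm (\<eta> f) powr p) / \<eta> f)" for f
    define g where "g x = (\<Sum>f\<leftarrow>L. b f * f x)" for x
    have g: "g \<in> dual_space s" "\<eta> g = (\<Sum>f\<leftarrow>L. b f * \<eta> f)"
      using bidual_space_sum_list[OF \<eta> L, of b] by (simp_all add: g_def[abs_def])
    have "(\<Sum>f\<leftarrow>L. b f * \<eta> f) = (\<Sum>f\<leftarrow>L. of_real (norm (\<eta> f) powr p))"
      by (intro arg_cong[of _ _ sum_list] map_cong) (auto simp: b_def)
    also have "\<dots> = of_real T"
      unfolding T_def by (induction L) auto
    finally have \<eta>g: "\<eta> g = of_real T" using g by simp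
    have "onorm g \<le> \<theta> * T + \<theta> powr (1 - p) * M"
    proof (rule onorm_le_unit_ball)
      show "bounded_linear g" using g dual_space_linear by blast
      fix x :: 'a assume x: "norm x \<le> 1"
      have "norm (g x) \<le> (\<Sum>f\<leftarrow>L. norm (b f * f x))"
        unfolding g_def by (induction L) (auto intro: norm_triangle_le)
      also have "\<dots> \<le> (\<Sum>f\<leftarrow>L. \<theta> * norm (\<eta> f) powr p + \<theta> powr (1 - p) * norm (f x) powr p)"
      proof (rule sum_list_mono)
        fix f
        show "norm (b f * f x) \<le> \<theta> * norm (\<eta> f) powr p + \<theta> powr (1 - p) * norm (f x) powr p"
        proof (cases "\<eta> f = 0")
          case False
          then show ?thesis
            using powr_young[OF _ _ \<theta>(1) p, of "norm (f x)" "norm (\<eta> f)"]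
            by (simp add: b_def norm_mult norm_divide)
        qed (simp add: b_def)
      qed
      also have "\<dots> = \<theta> * T + \<theta> powr (1 - p) * (\<Sum>f\<leftarrow>L. norm (f x) powr p)"
        by (simp add: T_def sum_list_addf sum_list_const_mult)
      also have "\<dots> \<le> \<theta> * T + \<theta> powr (1 - p) * M"
        using M[OF x] by (intro add_left_mono mult_left_mono) auto
      finally show "norm (g x) \<le> \<theta> * T + \<theta> powr (1 - p) * M" .
    qed
    moreover have "T \<le> H * onorm g"
    proof -
      have "T \<le> norm (\<eta> g)" by (simp add: \<eta>g)
      also have "\<dots> \<le> K * onorm g" using K g by blast
      also have "\<dots> \<le> H * onorm g"
        using H onorm_pos_le[OF dual_space_linear[OF g(1)]] by (intro mult_right_mono)
      finally show ?thesis .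
    qed
    ultimately have "T \<le> H * (\<theta> * T + \<theta> powr (1 - p) * M)"
      using H by (meson mult_left_mono less_imp_le order_trans)
    also have "\<dots> = (H * \<theta>) * T + H * \<theta> powr (1 - p) * M"
      by (simp add: algebra_simps)
    finally have "T \<le> (2 * H * \<theta> powr (1 - p)) * M"
      unfolding \<theta>(2) by simp
    then show "(\<Sum>f\<leftarrow>L. norm (\<eta> f) powr p) \<le> (2 * H * \<theta> powr (1 - p)) * M"
      by (simp only: T_def)
  qed
qed

text \<open>
  Finite blocks \<open>u k 0, ..., u k (len k - 1)\<close> are laid out as a single sequence by the pairing function
  of the naturals, with zeros at the positions outside the blocks.
\<close>

lemma summable_concat_iff:
  fixes u :: "nat \<Rightarrow> nat \<Rightarrow> real" and len :: "nat \<Rightarrow> nat"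
  assumes u: "\<And>k i. 0 \<le> u k i" and vanish: "\<And>k i. len k \<le> i \<Longrightarrow> u k i = 0"
  shows "summable (\<lambda>n. case prod_decode n of (k, i) \<Rightarrow> u k i) \<longleftrightarrow> summable (\<lambda>k. \<Sum>i<len k. u k i)"
    (is "summable ?v \<longleftrightarrow> summable ?w")
proof
  have v_nonneg: "0 \<le> ?v n" for n by (simp add: u split: prod.split)
  have w_nonneg: "0 \<le> ?w k" for k by (simp add: u sum_nonneg)
  {
    assume v: "summable ?v"
    show "summable ?w"
    proof (rule summableI_nonneg_bounded[OF w_nonneg])
      fix N
      have "(\<Sum>k<N. ?w k) = (\<Sum>(k, i)\<in>(SIGMA k:{..<N}. {..<len k}). u k i)"
        by (simp add: sum.Sigma)
      also have "\<dots> = (\<Sum>n\<in>prod_encode ` (SIGMA k:{..<N}. {..<len k}). ?v n)"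
        by (subst sum.reindex) (auto simp: inj_prod_encode inj_on_def)
      also have "\<dots> \<le> suminf ?v"
        by (intro sum_le_suminf v v_nonneg) auto
      finally show "(\<Sum>k<N. ?w k) \<le> suminf ?v" .
    qed
  next
    assume w: "summable ?w"
    show "summable ?v"
    proof (rule summableI_nonneg_bounded[OF v_nonneg])
      fix N
      have "(\<Sum>n<N. ?v n) = (\<Sum>(k, i)\<in>prod_decode ` {..<N}. u k i)"
        by (subst sum.reindex) (auto simp: inj_prod_decode)
      also have "\<dots> \<le> (\<Sum>(k, i)\<in>{..<N} \<times> {..<N}. u k i)"
      proof (rule sum_mono2)
        show "prod_decode ` {..<N} \<subseteq> {..<N} \<times> {..<N}"
        proof
          fix ki assume "ki \<in> prod_decode ` {..<N}"
          then have "prod_encode ki < N" by auto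
          then show "ki \<in> {..<N} \<times> {..<N}"
            using le_prod_encode_1[of "fst ki" "snd ki"] le_prod_encode_2[of "snd ki" "fst ki"]
            by (cases ki) auto
        qed
      qed (use u in auto)
      also have "\<dots> = (\<Sum>k<N. \<Sum>i<N. u k i)"
        by (simp add: sum.cartesian_product)
      also have "\<dots> \<le> (\<Sum>k<N. ?w k)"
      proof (rule sum_mono)
        fix k
        have "(\<Sum>i<N. u k i) = (\<Sum>i\<in>{..<N} \<inter> {..<len k}. u k i)"
        proof (rule sum.mono_neutral_right)
          show "\<forall>i\<in>{..<N} - {..<N} \<inter> {..<len k}. u k i = 0"
          proof
            fix i assume "i \<in> {..<N} - {..<N} \<inter> {..<len k}"
            then have "len k \<le> i" by auto
            then show "u k i = 0" by (rule vanish)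
          qed
        qed auto
        also have "\<dots> \<le> ?w k" using u by (intro sum_mono2) auto
        finally show "(\<Sum>i<N. u k i) \<le> ?w k" .
      qed
      also have "\<dots> \<le> suminf ?w"
        using w w_nonneg by (intro sum_le_suminf) auto
      finally show "(\<Sum>n<N. ?v n) \<le> suminf ?w" .
    qed
  }
qed

section \<open>The summing operator of a (V*) set\<close>

definition sup_norm :: "'a set \<Rightarrow> ('a \<Rightarrow> 'k::real_normed_vector) \<Rightarrow> real" where
  "sup_norm A f = (SUP a\<in>A. norm (f a))"

lemma Vstar_setD:
  assumes "Vstar_set p s A" "weakly_p_summable_dual p s \<phi>"
  shows "bdd_above ((\<lambda>a. norm (\<phi> n a)) ` A)" "in_lp p (\<lambda>n. sup_norm A (\<phi> n))"
  using assms by (simp_all add: Vstar_set_def sup_norm_def)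

lemma Vstar_set_bdd_above:
  assumes A: "Vstar_set p s A" and f: "f \<in> dual_space s"
  shows "bdd_above ((\<lambda>a. norm (f a)) ` A)"
proof -
  define \<phi> where "\<phi> n = (if n = (0::nat) then f else (\<lambda>x. 0))" for n
  have "in_lp p (\<lambda>n. \<eta> (\<phi> n))" if "\<eta> \<in> bidual_space s" for \<eta>
    unfolding in_lp_def using bidual_space_zero[OF that]
    by (intro summable_finite[of "{0}"]) (auto simp: \<phi>_def)
  then have "weakly_p_summable_dual p s \<phi>"
    using f dual_space_zero by (auto simp: weakly_p_summable_dual_def \<phi>_def)
  then have "bdd_above ((\<lambda>a. norm (\<phi> 0 a)) ` A)"
    by (rule Vstar_setD[OF A])
  then show ?thesis by (simp add: \<phi>_def)
qed

lemma Vstar_set_norm_le_sup_norm: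
  assumes "Vstar_set p s A" "f \<in> dual_space s" "a \<in> A"
  shows "norm (f a) \<le> sup_norm A f"
  unfolding sup_norm_def using Vstar_set_bdd_above[OF assms(1,2)] assms(3) by (rule cSUP_upper2) simp

lemma Vstar_set_sup_norm_nonneg:
  assumes "Vstar_set p s A" "f \<in> dual_space s"
  shows "0 \<le> sup_norm A f"
proof -
  obtain a where "a \<in> A" using assms(1) by (auto simp: Vstar_set_def)
  then show ?thesis
    using Vstar_set_norm_le_sup_norm[OF assms] norm_ge_zero order_trans by blast
qed

lemma Vstar_set_sup_norm_scale:
  fixes s :: "'k::real_normed_field \<Rightarrow> 'a::banach \<Rightarrow> 'a"
  assumes A: "Vstar_set p s A" and f: "f \<in> dual_space s" and c: "0 < c"
  shows "sup_norm A (\<lambda>x. of_real c * f x) = c * sup_norm A f"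
proof -
  have le: "sup_norm A (\<lambda>x. of_real c * f x) \<le> c * sup_norm A f"
    if c: "0 < c" and f: "f \<in> dual_space s" for c f
    unfolding sup_norm_def[of A "\<lambda>x. of_real c * f x"]
  proof (rule cSUP_least)
    show "A \<noteq> {}" using A by (simp add: Vstar_set_def)
    show "norm (of_real c * f a) \<le> c * sup_norm A f" if "a \<in> A" for a
      using Vstar_set_norm_le_sup_norm[OF A f that] c by (simp add: norm_mult)
  qed
  have "sup_norm A (\<lambda>x. of_real (1 / c) * (of_real c * f x)) \<le> 1 / c * sup_norm A (\<lambda>x. of_real c * f x)"
    using c dual_space_scale[OF f] by (intro le) auto
  then have "c * sup_norm A f \<le> sup_norm A (\<lambda>x. of_real c * f x)"
    using c by (simp add: field_simps)
  then show ?thesis using le[OF c f] by simp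
qed

text \<open>
  A closed graph argument by gluing: if no \<open>K\<close> works, there is for each \<open>k\<close> a finite family with weak
  \<open>p\<close>-sum at most \<open>2\<^bsup>-k\<^esup>\<close> and strong \<open>p\<close>-sum \<open>1\<close>. Concatenating these families yields a weakly
  \<open>p\<close>-summable sequence whose suprema over \<open>A\<close> are not in \<open>\<ell>\<^sub>p\<close>. The conclusion says that
  \<open>f \<mapsto> (f a)\<^bsub>a \<in> A\<^esub>\<close> is a \<open>p\<close>-summing operator from the dual space to the bounded functions on \<open>A\<close>.
\<close>

lemma Vstar_set_summing:
  fixes s :: "'k::real_normed_field \<Rightarrow> 'a::banach \<Rightarrow> 'a" and p :: real
  assumes p: "1 \<le> p" and A: "Vstar_set p s A"
  obtains K where "0 \<le> K"
    "\<And>L M. set L \<subseteq> dual_space s \<Longrightarrow> (\<And>x. norm x \<le> 1 \<Longrightarrow> (\<Sum>f\<leftarrow>L. norm (f x) powr p) \<le> M) \<Longrightarrow>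
      (\<Sum>f\<leftarrow>L. sup_norm A f powr p) \<le> K * M"
proof (rule ccontr)
  assume no_K: "\<not> thesis"
  let ?D = "dual_space s"
  have "\<exists>L. set L \<subseteq> ?D \<and> (\<forall>x. norm x \<le> 1 \<longrightarrow> (\<Sum>f\<leftarrow>L. norm (f x) powr p) \<le> (1 / 2) ^ k)
      \<and> (\<Sum>f\<leftarrow>L. sup_norm A f powr p) = 1" for k :: nat
  proof -
    have "\<exists>L M. set L \<subseteq> ?D \<and> (\<forall>x. norm x \<le> 1 \<longrightarrow> (\<Sum>f\<leftarrow>L. norm (f x) powr p) \<le> M)
        \<and> 2 ^ k * M < (\<Sum>f\<leftarrow>L. sup_norm A f powr p)"
    proof (rule ccontr)
      assume "\<not> ?thesis"
      then show False
        using no_K that[of "2 ^ k"] by (force simp: not_less)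
    qed
    then obtain L M where L: "set L \<subseteq> ?D"
      and M: "\<And>x. norm x \<le> 1 \<Longrightarrow> (\<Sum>f\<leftarrow>L. norm (f x) powr p) \<le> M"
      and less: "2 ^ k * M < (\<Sum>f\<leftarrow>L. sup_norm A f powr p)"
      by blast
    define T where "T = (\<Sum>f\<leftarrow>L. sup_norm A f powr p)"
    have "0 \<le> (\<Sum>f\<leftarrow>L. norm (f 0) powr p)"
      by (intro sum_list_nonneg) auto
    also have "\<dots> \<le> M" by (rule M) simp
    finally have "0 \<le> 2 ^ k * M" by simp
    then have T: "0 < T" using less by (simp add: T_def)
    \<comment> \<open>The scaling is by the strong sum \<open>T\<close>, which is positive, and not by \<open>M\<close>, which may be \<open>0\<close>.\<close>
    define c where "c = T powr (- 1 / p)"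
    have c: "0 < c" using T by (simp add: c_def)
    have "c powr p = T powr (- 1 / p * p)"
      by (simp only: c_def powr_powr)
    also have "\<dots> = 1 / T"
      using p T by (simp add: powr_neg_one)
    finally have cp: "c powr p = 1 / T" .
    define L' where "L' = map (\<lambda>f x. of_real c * f x) L"
    have "set L' \<subseteq> ?D"
      using L by (auto simp: L'_def intro: dual_space_scale)
    moreover have "(\<Sum>f\<leftarrow>L'. norm (f x) powr p) \<le> (1 / 2) ^ k" if x: "norm x \<le> 1" for x
    proof -
      have "(\<Sum>f\<leftarrow>L'. norm (f x) powr p) = (\<Sum>f\<leftarrow>L. (1 / T) * norm (f x) powr p)"
        using c by (simp add: L'_def o_def norm_mult powr_mult cp)
      also have "\<dots> = (1 / T) * (\<Sum>f\<leftarrow>L. norm (f x) powr p)"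
        by (rule sum_list_const_mult)
      also have "\<dots> \<le> (1 / T) * M"
        using M[OF x] T by (intro mult_left_mono) auto
      also have "\<dots> \<le> (1 / 2) ^ k"
        using less T by (simp add: T_def[symmetric] field_simps)
      finally show ?thesis .
    qed
    moreover have "(\<Sum>f\<leftarrow>L'. sup_norm A f powr p) = 1"
    proof -
      have "(\<Sum>f\<leftarrow>L'. sup_norm A f powr p) = (\<Sum>f\<leftarrow>L. (1 / T) * sup_norm A f powr p)"
        unfolding L'_def map_map o_def
      proof (intro arg_cong[of _ _ sum_list] map_cong refl)
        fix f assume "f \<in> set L"
        then have f: "f \<in> ?D" using L by auto
        then show "sup_norm A (\<lambda>x. of_real c * f x) powr p = 1 / T * sup_norm A f powr p"
          using Vstar_set_sup_norm_nonneg[OF A f] c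
          by (simp add: Vstar_set_sup_norm_scale[OF A f c] powr_mult cp)
      qed
      also have "\<dots> = (1 / T) * T"
        unfolding T_def by (rule sum_list_const_mult)
      finally show ?thesis using T by simp
    qed
    ultimately show ?thesis by blast
  qed
  then obtain L where L: "\<And>k. set (L k) \<subseteq> ?D"
    and weak: "\<And>k x. norm x \<le> 1 \<Longrightarrow> (\<Sum>f\<leftarrow>L k. norm (f x) powr p) \<le> (1 / 2) ^ k"
    and strong: "\<And>k. (\<Sum>f\<leftarrow>L k. sup_norm A f powr p) = 1"
    by metis
  define \<psi> where "\<psi> k i = (if i < length (L k) then L k ! i else (\<lambda>x. 0))" for k i :: nat
  define \<phi> where "\<phi> n = (case prod_decode n of (k, i) \<Rightarrow> \<psi> k i)" for n
  have \<psi>: "\<psi> k i \<in> ?D" for k i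
    using L[of k] by (auto simp: \<psi>_def dual_space_zero)
  have concat: "summable (\<lambda>n. h (\<phi> n)) \<longleftrightarrow> summable (\<lambda>k. \<Sum>f\<leftarrow>L k. h f)"
    if "h (\<lambda>x. 0) = 0" "\<And>f. f \<in> ?D \<Longrightarrow> 0 \<le> h f" for h :: "('a \<Rightarrow> 'k) \<Rightarrow> real"
  proof -
    have "(\<Sum>f\<leftarrow>L k. h f) = (\<Sum>i<length (L k). h (\<psi> k i))" for k
      by (simp add: sum_list_sum_nth atLeast0LessThan \<psi>_def)
    moreover have "h (\<phi> n) = (case prod_decode n of (k, i) \<Rightarrow> h (\<psi> k i))" for n
      by (simp add: \<phi>_def split: prod.split)
    ultimately show ?thesis
      using summable_concat_iff[of "\<lambda>k i. h (\<psi> k i)" "\<lambda>k. length (L k)"] that \<psi>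
      by (simp add: \<psi>_def)
  qed
  have "weakly_p_summable_dual p s \<phi>"
    unfolding weakly_p_summable_dual_def
  proof (intro conjI allI ballI)
    show "\<phi> n \<in> ?D" for n using \<psi> by (simp add: \<phi>_def split: prod.split)
    fix \<eta> assume \<eta>: "\<eta> \<in> bidual_space s"
    obtain C where C: "\<And>L M. set L \<subseteq> ?D \<Longrightarrow>
        (\<And>x. norm x \<le> 1 \<Longrightarrow> (\<Sum>f\<leftarrow>L. norm (f x) powr p) \<le> M) \<Longrightarrow>
        (\<Sum>f\<leftarrow>L. norm (\<eta> f) powr p) \<le> C * M"
      using bidual_weak_bound[OF p \<eta>] by metis
    have "summable (\<lambda>k. \<Sum>f\<leftarrow>L k. norm (\<eta> f) powr p)"
    proof (rule summable_comparison_test')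
      show "summable (\<lambda>k. C * (1 / 2) ^ k)" by (intro summable_mult summable_geometric) simp
      show "norm (\<Sum>f\<leftarrow>L k. norm (\<eta> f) powr p) \<le> C * (1 / 2) ^ k" for k
      proof -
        have "0 \<le> (\<Sum>f\<leftarrow>L k. norm (\<eta> f) powr p)"
          by (intro sum_list_nonneg) auto
        then show ?thesis using C[OF L weak, of k] by simp
      qed
    qed
    then show "in_lp p (\<lambda>n. \<eta> (\<phi> n))"
      unfolding in_lp_def using concat[of "\<lambda>f. norm (\<eta> f) powr p"] bidual_space_zero[OF \<eta>] by simp
  qed
  then have "in_lp p (\<lambda>n. sup_norm A (\<phi> n))"
    by (rule Vstar_setD[OF A])
  then have "summable (\<lambda>n. \<bar>sup_norm A (\<phi> n)\<bar> powr p)"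
    by (simp add: in_lp_def)
  moreover have "sup_norm A (\<lambda>x. 0 :: 'k) = 0"
    using A by (simp add: sup_norm_def Vstar_set_def)
  moreover have "(\<Sum>f\<leftarrow>L k. \<bar>sup_norm A f\<bar> powr p) = 1" for k
  proof -
    have "(\<Sum>f\<leftarrow>L k. \<bar>sup_norm A f\<bar> powr p) = (\<Sum>f\<leftarrow>L k. sup_norm A f powr p)"
      using L[of k] Vstar_set_sup_norm_nonneg[OF A]
      by (intro arg_cong[of _ _ sum_list] map_cong) (auto simp: subset_iff)
    then show ?thesis using strong by simp
  qed
  ultimately have "summable (\<lambda>k::nat. 1 :: real)"
    using concat[of "\<lambda>f. \<bar>sup_norm A f\<bar> powr p"] by simp
  then show False by (simp add: summable_const_iff)
qed

lemma bounded_functions_norm_power: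
  assumes "f \<in> dual_space s"
  shows "(\<lambda>x. norm (f x) ^ n) \<in> bounded_functions (cball 0 1)"
    and "0 \<le> p \<Longrightarrow> (\<lambda>x. norm (f x) powr p) \<in> bounded_functions (cball 0 1)"
proof -
  have *: "norm (f x) \<le> onorm f" if "x \<in> cball 0 1" for x
  proof -
    have "norm (f x) \<le> onorm f * norm x"
      by (rule onorm[OF dual_space_linear[OF assms]])
    also have "\<dots> \<le> onorm f * 1"
      using that onorm_pos_le[OF dual_space_linear[OF assms]] by (intro mult_left_mono) auto
    finally show ?thesis by simp
  qed
  show "(\<lambda>x. norm (f x) ^ n) \<in> bounded_functions (cball 0 1)"
  proof (rule bounded_functionsI)
    show "\<bar>norm (f x) ^ n\<bar> \<le> onorm f ^ n" if "x \<in> cball 0 1" for x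
      using power_mono[OF *[OF that], of n] by simp
  qed
  show "(\<lambda>x. norm (f x) powr p) \<in> bounded_functions (cball 0 1)" if "0 \<le> p"
  proof (rule bounded_functionsI)
    show "\<bar>norm (f x) powr p\<bar> \<le> onorm f powr p" if "x \<in> cball 0 1" for x
      using powr_mono2[OF \<open>0 \<le> p\<close> norm_ge_zero *[OF that]] by simp
  qed
qed

text \<open>
  Pietsch domination for the \<open>p\<close>-summing operator given by \<open>A\<close>, with a finitely additive measure on the
  unit ball of the space. The cone consists of the pairs of weak and strong \<open>p\<close>-sums of finite families.
  It is closed under positive multiples because a family can be scaled by \<open>t\<^bsup>1/p\<^esup>\<close>.
\<close>

lemma Vstar_set_pietsch:
  fixes s :: "'k::real_normed_field \<Rightarrow> 'a::banach \<Rightarrow> 'a" and p :: real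
  assumes p: "1 \<le> p" and A: "Vstar_set p s A"
  obtains \<Lambda> K where "0 \<le> K"
    "dominated_functional (cball 0 1) K \<Lambda>"
    "\<And>f. f \<in> dual_space s \<Longrightarrow> sup_norm A f powr p \<le> \<Lambda> (\<lambda>x. norm (f x) powr p)"
proof -
  let ?D = "dual_space s" and ?B = "bounded_functions (cball (0::'a) 1)"
  obtain K where K: "0 \<le> K" and summing:
    "\<And>L M. set L \<subseteq> ?D \<Longrightarrow> (\<And>x. norm x \<le> 1 \<Longrightarrow> (\<Sum>f\<leftarrow>L. norm (f x) powr p) \<le> M) \<Longrightarrow>
      (\<Sum>f\<leftarrow>L. sup_norm A f powr p) \<le> K * M"
    using Vstar_set_summing[OF p A] by metis
  define g where "g L x = (\<Sum>f\<leftarrow>L. norm (f x) powr p)" for L :: "('a \<Rightarrow> 'k) list" and x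
  define b where "b L = (\<Sum>f\<leftarrow>L. sup_norm A f powr p)" for L :: "('a \<Rightarrow> 'k) list"
  define cone where "cone = {(g L, b L) | L. set L \<subseteq> ?D}"
  have coneI: "(h, c) \<in> cone" if "set L \<subseteq> ?D" "h = g L" "c = b L" for L h c
    using that by (auto simp: cone_def)
  have coneE: thesis if "(h, c) \<in> cone" "\<And>L. set L \<subseteq> ?D \<Longrightarrow> h = g L \<Longrightarrow> c = b L \<Longrightarrow> thesis" for h c thesis
    using that by (auto simp: cone_def)
  show ?thesis
  proof (rule pietsch_domination[of cone "cball 0 1" K])
    show "(\<lambda>x. 0, 0) \<in> cone"
      by (rule coneI[of "[]"]) (simp_all add: g_def b_def fun_eq_iff)
  next
    fix h c h' c' assume "(h, c) \<in> cone" "(h', c') \<in> cone"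
    then obtain L L' where L: "set L \<subseteq> ?D" "h = g L" "c = b L" "set L' \<subseteq> ?D" "h' = g L'" "c' = b L'"
      by (elim coneE)
    then show "(\<lambda>x. h x + h' x, c + c') \<in> cone"
      by (intro coneI[of "L @ L'"]) (simp_all add: g_def b_def fun_eq_iff)
  next
    fix h c and t :: real assume "(h, c) \<in> cone" and t: "0 < t"
    then obtain L where L: "set L \<subseteq> ?D" "h = g L" "c = b L"
      by (elim coneE)
    define r where "r = t powr (1 / p)"
    have r: "0 < r" "r powr p = t"
      using t p by (simp_all add: r_def powr_powr)
    show "(\<lambda>x. t * h x, t * c) \<in> cone"
    proof (rule coneI[of "map (\<lambda>f x. of_real r * f x) L"])
      show "set (map (\<lambda>f x. of_real r * f x) L) \<subseteq> ?D"
        using L by (auto intro: dual_space_scale)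
      show "(\<lambda>x. t * h x) = g (map (\<lambda>f x. of_real r * f x) L)"
        using r by (simp add: L g_def fun_eq_iff o_def norm_mult powr_mult sum_list_const_mult)
      have "b (map (\<lambda>f x. of_real r * f x) L) = (\<Sum>f\<leftarrow>L. t * sup_norm A f powr p)"
        unfolding b_def map_map o_def
      proof (intro arg_cong[of _ _ sum_list] map_cong refl)
        fix f assume "f \<in> set L"
        then have f: "f \<in> ?D" using L by auto
        then show "sup_norm A (\<lambda>x. of_real r * f x) powr p = t * sup_norm A f powr p"
          using Vstar_set_sup_norm_nonneg[OF A f] r
          by (simp add: Vstar_set_sup_norm_scale[OF A f] powr_mult)
      qed
      then show "t * c = b (map (\<lambda>f x. of_real r * f x) L)"
        by (simp add: L b_def sum_list_const_mult)
    qed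
  next
    fix h c assume "(h, c) \<in> cone"
    then obtain L where L: "set L \<subseteq> ?D" "h = g L"
      by (elim coneE)
    have "g L \<in> ?B"
      using L(1)
    proof (induction L)
      case Nil
      then show ?case by (auto simp: g_def intro: bounded_functionsI[of _ _ 0])
    next
      case (Cons f L)
      then have "(\<lambda>x. norm (f x) powr p + g L x) \<in> ?B"
        using p by (intro bounded_functions_add bounded_functions_norm_power) auto
      moreover have "g (f # L) = (\<lambda>x. norm (f x) powr p + g L x)"
        by (simp add: g_def fun_eq_iff)
      ultimately show ?case by simp
    qed
    then show "h \<in> ?B" using L by simp
  next
    fix h c M assume "(h, c) \<in> cone" and le: "\<And>x. x \<in> cball 0 1 \<Longrightarrow> h x \<le> M"
    then obtain L where L: "set L \<subseteq> ?D" "h = g L" "c = b L"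
      by (elim coneE)
    show "c \<le> K * M"
      unfolding L b_def by (rule summing[OF L(1)]) (use le in \<open>simp add: L g_def\<close>)
  next
    fix \<Lambda> assume \<Lambda>: "dominated_functional (cball 0 1) K \<Lambda>" "\<And>h c. (h, c) \<in> cone \<Longrightarrow> c \<le> \<Lambda> h"
    show thesis
    proof (rule that[OF K \<Lambda>(1)])
      show "sup_norm A f powr p \<le> \<Lambda> (\<lambda>x. norm (f x) powr p)" if "f \<in> ?D" for f
        by (rule \<Lambda>(2), rule coneI[of "[f]"]) (use that in \<open>simp_all add: g_def b_def fun_eq_iff\<close>)
    qed
  qed
qed

section \<open>Relative weak compactness from pointwise limits\<close>

text \<open>
  The weak topology is no finer than the one induced by the evaluation map into the product of copies
  of the scalar field, because its subbasic sets are preimages of cylinders.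
\<close>

lemma openin_weak_topology_pullback:
  assumes "openin (weak_topology s) U"
  obtains O' where "openin (product_topology (\<lambda>_. euclidean) (dual_space s)) O'"
    "U = (\<lambda>x. restrict (\<lambda>f. f x) (dual_space s)) -` O'"
proof -
  let ?T = "product_topology (\<lambda>_. euclidean) (dual_space s)"
  let ?\<Phi> = "\<lambda>x. restrict (\<lambda>f. f x) (dual_space s)"
  have gen: "generate_topology_on {f -` U | f U. f \<in> dual_space s \<and> open U} U"
    using assms by (simp add: weak_topology_def openin_topology_generated_by_iff)
  have "openin (pullback_topology UNIV ?\<Phi> ?T) U"
  proof (rule generate_topology_on_coarsest[OF _ _ gen])
    show "istopology (openin (pullback_topology UNIV ?\<Phi> ?T))" by simp
    fix V assume "V \<in> {f -` U | f U. f \<in> dual_space s \<and> open U}"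
    then obtain f X where f: "f \<in> dual_space s" and X: "open X" and V: "V = f -` X" by blast
    have "openin ?T {g \<in> topspace ?T. g f \<in> X}"
      using continuous_map_product_projection[OF f, of "\<lambda>_. euclidean"] X
      by (intro openin_continuous_map_preimage) auto
    moreover have "V = ?\<Phi> -` {g \<in> topspace ?T. g f \<in> X}"
      using f by (auto simp: V)
    ultimately show "openin (pullback_topology UNIV ?\<Phi> ?T) V"
      unfolding openin_pullback_topology by blast
  qed
  then show ?thesis
    using that unfolding openin_pullback_topology by auto
qed

lemma continuous_map_weak_topology:
  fixes f :: "'a::banach \<Rightarrow> 'k::real_normed_field"
  assumes "f \<in> dual_space s"
  shows "continuous_map (weak_topology s) euclidean f"
  unfolding continuous_map_def
proof (intro conjI allI impI)
  fix U :: "'k set" assume "openin euclidean U"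
  then have "f -` U \<in> {f -` U | f U. f \<in> dual_space s \<and> open U}"
    using assms by auto
  then have "openin (weak_topology s) (f -` U)"
    unfolding weak_topology_def by (rule topology_generated_by_Basis)
  then show "openin (weak_topology s) {x \<in> topspace (weak_topology s). f x \<in> U}"
    by (simp add: vimage_def)
qed auto

text \<open>
  By Tychonoff the closure \<open>Z\<close> of \<open>A\<close> in the product of scalar fields over the dual space is compact.
  The second hypothesis places \<open>Z\<close> inside the image of the evaluation map, so its preimage is weakly
  compact, and the weak closure of \<open>A\<close> is a closed part of it.
\<close>

lemma relatively_weakly_compactI:
  fixes s :: "'k::{real_normed_field,heine_borel} \<Rightarrow> 'a::banach \<Rightarrow> 'a"
  assumes bdd: "\<And>f. f \<in> dual_space s \<Longrightarrow> \<exists>B. \<forall>a\<in>A. norm (f a) \<le> B"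
    and lim: "\<And>\<eta>. (\<And>F e. finite F \<Longrightarrow> F \<subseteq> dual_space s \<Longrightarrow> 0 < e \<Longrightarrow> \<exists>a\<in>A. \<forall>f\<in>F. norm (f a - \<eta> f) < e)
      \<Longrightarrow> \<exists>x. \<forall>f\<in>dual_space s. f x = \<eta> f"
  shows "relatively_weakly_compact s A"
proof -
  let ?D = "dual_space s"
  let ?W = "weak_topology s"
  let ?T = "product_topology (\<lambda>_. euclidean) ?D :: (('a \<Rightarrow> 'k) \<Rightarrow> 'k) topology"
  define \<Phi> where "\<Phi> x = restrict (\<lambda>f. f x) ?D" for x
  define Z where "Z = ?T closure_of (\<Phi> ` A)"
  have \<Phi>: "continuous_map ?W ?T \<Phi>"
  proof -
    have "continuous_map ?W euclidean (\<lambda>x. \<Phi> x f)" if "f \<in> ?D" for f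
      using continuous_map_weak_topology[OF that] that by (simp add: \<Phi>_def)
    then show ?thesis
      by (auto simp: continuous_map_componentwise \<Phi>_def)
  qed
  have Z: "compactin ?T Z"
  proof -
    obtain B where B: "\<And>f a. f \<in> ?D \<Longrightarrow> a \<in> A \<Longrightarrow> norm (f a) \<le> B f"
      using bdd by metis
    let ?P = "PiE ?D (\<lambda>f. cball 0 (B f))"
    have P: "compactin ?T ?P" "closedin ?T ?P"
      by (auto simp: compactin_PiE closedin_product_topology)
    have "\<Phi> ` A \<subseteq> ?P"
      using B by (simp add: \<Phi>_def image_subset_iff restrict_PiE_iff)
    then have "Z \<subseteq> ?P"
      unfolding Z_def using P(2) by (rule closure_of_minimal)
    moreover have "closedin ?T Z"
      by (simp add: Z_def)
    ultimately show ?thesis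
      by (rule closed_compactin[OF P(1)])
  qed
  have Z_range: "Z \<subseteq> range \<Phi>"
  proof
    fix \<eta> assume \<eta>: "\<eta> \<in> Z"
    have approx: "\<exists>a\<in>A. \<forall>f\<in>F. norm (f a - \<eta> f) < e" if F: "finite F" "F \<subseteq> ?D" and e: "0 < e" for F e
    proof -
      define V where "V = (\<Inter>f\<in>F. {g \<in> topspace ?T. g f \<in> ball (\<eta> f) e}) \<inter> topspace ?T"
      have "openin ?T V"
        unfolding V_def
      proof (intro openin_INT F)
        fix f assume "f \<in> F"
        then have "f \<in> ?D" using F by auto
        then show "openin ?T {g \<in> topspace ?T. g f \<in> ball (\<eta> f) e}"
          using continuous_map_product_projection[of f ?D "\<lambda>_. euclidean"]
          by (intro openin_continuous_map_preimage) auto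
      qed
      moreover have "\<eta> \<in> V"
        using \<eta> e unfolding V_def Z_def in_closure_of by simp
      ultimately obtain a where "a \<in> A" "\<Phi> a \<in> V"
        using \<eta> unfolding Z_def in_closure_of by blast
      then show ?thesis
        using F by (intro bexI[of _ a]) (auto simp: V_def \<Phi>_def dist_norm norm_minus_commute subset_iff)
    qed
    have "\<exists>x. \<forall>f\<in>?D. f x = \<eta> f"
      by (rule lim) (rule approx)
    then obtain x where x: "\<And>f. f \<in> ?D \<Longrightarrow> f x = \<eta> f"
      by blast
    have "\<eta> \<in> extensional ?D"
      using \<eta> by (auto simp: Z_def in_closure_of PiE_def)
    then have "\<eta> = \<Phi> x"
      using x by (auto simp: \<Phi>_def extensional_def restrict_def fun_eq_iff)
    then show "\<eta> \<in> range \<Phi>" by simp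
  qed
  have "compactin ?W (\<Phi> -` Z)"
    unfolding compactin_def
  proof (intro conjI allI impI)
    show "\<Phi> -` Z \<subseteq> topspace ?W" by simp
    fix \<U> assume \<U>: "Ball \<U> (openin ?W) \<and> \<Phi> -` Z \<subseteq> \<Union> \<U>"
    have "\<exists>O'. openin ?T O' \<and> U = \<Phi> -` O'" if "U \<in> \<U>" for U
      using openin_weak_topology_pullback[of s U] \<U> that unfolding \<Phi>_def by metis
    then obtain O' where O': "\<And>U. U \<in> \<U> \<Longrightarrow> openin ?T (O' U)" "\<And>U. U \<in> \<U> \<Longrightarrow> U = \<Phi> -` O' U"
      by metis
    have "Z \<subseteq> \<Union> (O' ` \<U>)"
    proof
      fix \<eta> assume "\<eta> \<in> Z"
      then obtain x where x: "\<eta> = \<Phi> x" "x \<in> \<Phi> -` Z" using Z_range by auto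
      then obtain U where "U \<in> \<U>" "x \<in> U" using \<U> by blast
      then show "\<eta> \<in> \<Union> (O' ` \<U>)" using O'(2)[of U] x by auto
    qed
    moreover have "openin ?T V" if "V \<in> O' ` \<U>" for V
      using that O'(1) by auto
    ultimately obtain \<F> where \<F>: "finite \<F>" "\<F> \<subseteq> O' ` \<U>" "Z \<subseteq> \<Union> \<F>"
      using compactinD[OF Z, of "O' ` \<U>"] by auto
    obtain \<V> where \<V>: "\<V> \<subseteq> \<U>" "finite \<V>" "Z \<subseteq> \<Union> (O' ` \<V>)"
      using finite_subset_image[OF \<F>(1,2)] \<F>(3) by auto
    have "\<Phi> -` Z \<subseteq> \<Union> \<V>"
    proof
      fix x assume "x \<in> \<Phi> -` Z"
      then obtain U where "U \<in> \<V>" "\<Phi> x \<in> O' U" using \<V> by auto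
      then show "x \<in> \<Union> \<V>" using O'(2)[of U] \<V> by auto
    qed
    then show "\<exists>\<F>. finite \<F> \<and> \<F> \<subseteq> \<U> \<and> \<Phi> -` Z \<subseteq> \<Union> \<F>" using \<V> by blast
  qed
  moreover have "?W closure_of A \<subseteq> \<Phi> -` Z"
    using continuous_map_image_closure_subset[OF \<Phi>, of A] by (auto simp: Z_def)
  ultimately show ?thesis
    unfolding relatively_weakly_compact_def by (rule closed_compactin) simp
qed

section \<open>Compactness of (V*) sets\<close>

text \<open>
  The dominating functional \<open>\<Lambda>\<close> is used with an even exponent \<open>2 m \<ge> p\<close>: as \<open>y powr p \<le> 1 + y ^ (2 * m)\<close>, a
  functional with \<open>\<Lambda> (\<bar>f\<bar>\<^bsup>2m\<^esup>) \<le> 1\<close> is bounded by \<open>K + 1\<close> on \<open>A\<close>. So \<open>A\<close> lies in a polar ball of the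
  smooth seminorm \<open>\<Lambda> (\<bar>f\<bar>\<^bsup>2m\<^esup>)\<^bsup>1/2m\<^esup>\<close>, and all its pointwise limits are evaluations. Raising the exponent
  is what provides smoothness, which \<open>L\<^sub>p\<close> has only to a lower order for \<open>1 < p < 2\<close> and not at all for
  \<open>p = 1\<close>.
\<close>

theorem Vstar_set_relatively_weakly_compact:
  fixes s :: "'k::{real_normed_field,euclidean_space} \<Rightarrow> 'a::banach \<Rightarrow> 'a" and p :: real
  assumes norming: "norming_dual s" and p: "1 \<le> p" and A: "Vstar_set p s A"
  shows "relatively_weakly_compact s A"
proof -
  let ?D = "dual_space s" and ?B = "bounded_functions (cball (0::'a) 1)"
  obtain \<Lambda> K where K: "0 \<le> K"
    and \<Lambda>: "dominated_functional (cball 0 1) K \<Lambda>"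
    and \<Lambda>_dom: "\<And>f. f \<in> ?D \<Longrightarrow> sup_norm A f powr p \<le> \<Lambda> (\<lambda>x. norm (f x) powr p)"
    using Vstar_set_pietsch[OF p A] by metis
  note \<Lambda>_add = dominated_functional_add[OF \<Lambda>]
    and \<Lambda>_scale = dominated_functional_scale[OF \<Lambda>]
    and \<Lambda>_le = dominated_functional_le[OF \<Lambda>]
    and \<Lambda>_mono = dominated_functional_mono[OF \<Lambda>]
  define m where "m = nat \<lceil>p\<rceil>"
  have m: "1 \<le> m" "p \<le> real m" using p by (auto simp: m_def) linarith+
  define \<nu> where "\<nu> f x = norm (f x) ^ (2 * m)" for f :: "'a \<Rightarrow> 'k" and x
  define G where "G f = \<Lambda> (\<nu> f)" for f :: "'a \<Rightarrow> 'k"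
  define \<kappa> where "\<kappa> = max K 1"
  have \<kappa>: "K \<le> \<kappa>" "1 \<le> \<kappa>" by (simp_all add: \<kappa>_def)
  have \<nu>: "\<nu> f \<in> ?B" if "f \<in> ?D" for f
    unfolding \<nu>_def[abs_def] using bounded_functions_norm_power(1)[OF that] .
  have G_scale: "G (\<lambda>x. a * f x) = norm a ^ (2 * m) * G f" if "f \<in> ?D" for a f
    using \<Lambda>_scale[OF \<nu>[OF that], of "norm a ^ (2 * m)"]
    by (simp add: G_def \<nu>_def[abs_def] norm_mult power_mult_distrib)
  interpret smooth_gauge ?D G "2 * m" "4 * 4 ^ m" \<kappa>
  proof (rule smooth_gauge.intro)
    show "bounded_linear f" if "f \<in> ?D" for f
      using that by (rule dual_space_linear)
    show "(\<lambda>x. f x + g x) \<in> ?D" if "f \<in> ?D" "g \<in> ?D" for f g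
      using that by (rule dual_space_add)
    show "(\<lambda>x. a * f x) \<in> ?D" if "f \<in> ?D" for a f
      using that by (rule dual_space_scale)
    show "0 \<le> G f" if f: "f \<in> ?D" for f
    proof -
      have "\<Lambda> (\<lambda>x. 0 * \<nu> f x) \<le> \<Lambda> (\<nu> f)"
        by (intro \<Lambda>_mono bounded_functions_scale \<nu> f) (simp add: \<nu>_def)
      then show ?thesis
        unfolding \<Lambda>_scale[OF \<nu>[OF f]] by (simp add: G_def)
    qed
    show "G (\<lambda>x. a * f x) = norm a ^ (2 * m) * G f" if "f \<in> ?D" for a f
      using that by (rule G_scale)
    show "G (\<lambda>x. f x + of_real t * g x) + G (\<lambda>x. f x - of_real t * g x)
        \<le> 2 * G f + 4 * 4 ^ m * t\<^sup>2 * (G f + G g)"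
      if f: "f \<in> ?D" and g: "g \<in> ?D" and t: "0 \<le> t" "t \<le> 1" for f g t
    proof -
      let ?c = "4 * 4 ^ m * t\<^sup>2"
      define p q where "p x = f x + of_real t * g x" and "q x = f x - of_real t * g x" for x
      have p: "p \<in> ?D" unfolding p_def
        using dual_space_add[OF f dual_space_scale[OF g]] by simp
      have q: "q \<in> ?D" unfolding q_def
        using dual_space_add[OF f dual_space_scale[OF g, of "- of_real t"]] by simp
      \<comment> \<open>The pointwise inequality for even powers is integrated against \<open>\<Lambda>\<close>.\<close>
      have "\<Lambda> (\<nu> p) + \<Lambda> (\<nu> q) = \<Lambda> (\<lambda>x. \<nu> p x + \<nu> q x)"
        by (rule \<Lambda>_add[symmetric]) (simp_all add: \<nu> p q)
      also have "\<dots> \<le> \<Lambda> (\<lambda>x. 2 * \<nu> f x + ?c * (\<nu> f x + \<nu> g x))"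
      proof (rule \<Lambda>_mono)
        show "\<nu> p x + \<nu> q x \<le> 2 * \<nu> f x + ?c * (\<nu> f x + \<nu> g x)" for x
          using norm_even_power_smoothness[OF t, of "f x" "g x" m]
          by (simp add: \<nu>_def p_def q_def scaleR_conv_of_real)
      qed (intro bounded_functions_add bounded_functions_scale \<nu> f g p q)+
      also have "\<dots> = \<Lambda> (\<lambda>x. 2 * \<nu> f x) + \<Lambda> (\<lambda>x. ?c * (\<nu> f x + \<nu> g x))"
        by (intro \<Lambda>_add bounded_functions_add bounded_functions_scale \<nu> f g)
      also have "\<Lambda> (\<lambda>x. 2 * \<nu> f x) = 2 * \<Lambda> (\<nu> f)"
        by (intro \<Lambda>_scale \<nu> f)
      also have "\<Lambda> (\<lambda>x. ?c * (\<nu> f x + \<nu> g x)) = ?c * \<Lambda> (\<lambda>x. \<nu> f x + \<nu> g x)"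
        by (intro \<Lambda>_scale bounded_functions_add \<nu> f g)
      also have "\<Lambda> (\<lambda>x. \<nu> f x + \<nu> g x) = \<Lambda> (\<nu> f) + \<Lambda> (\<nu> g)"
        by (intro \<Lambda>_add \<nu> f g)
      finally show ?thesis by (simp only: G_def p_def[abs_def] q_def[abs_def])
    qed
    show "2 \<le> 2 * m" using m by simp
    show "0 \<le> (4 * 4 ^ m :: real)" "0 \<le> \<kappa>" using \<kappa> by simp_all
    show "\<exists>f\<in>?D. G f \<le> 1 \<and> norm x \<le> \<kappa> * norm (f x)" for x
    proof -
      obtain f where f: "f \<in> ?D" "\<And>y. norm (f y) \<le> norm y" "norm (f x) = norm x"
        using norming unfolding norming_dual_def by blast
      have "G f \<le> K * 1"
        unfolding G_def
      proof (rule \<Lambda>_le[OF \<nu>[OF f(1)]])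
        show "\<nu> f y \<le> 1" if "y \<in> cball 0 1" for y
        proof -
          have "norm (f y) \<le> 1" using f(2)[of y] that by simp
          then show ?thesis unfolding \<nu>_def by (intro power_le_one) auto
        qed
      qed
      also have "\<dots> \<le> \<kappa> ^ (2 * m)"
        using \<kappa> m self_le_power[of \<kappa> "2 * m"] by simp
      finally have "inverse \<kappa> ^ (2 * m) * G f \<le> 1"
        using \<kappa> by (simp add: field_simps)
      then have "G (\<lambda>x. of_real (inverse \<kappa>) * f x) \<le> 1"
        unfolding G_scale[OF f(1)] using \<kappa> by (simp add: norm_inverse)
      moreover have "norm x = \<kappa> * norm (of_real (inverse \<kappa>) * f x)"
        using \<kappa> f(3) by (simp add: norm_mult norm_inverse)
      ultimately show ?thesis
        using dual_space_scale[OF f(1)] by (intro bexI[of _ "\<lambda>x. of_real (inverse \<kappa>) * f x"]) auto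
    qed
  qed
  have A_polar: "A \<subseteq> polar_ball (K + 1)"
    unfolding polar_ball_def
  proof (intro subsetI CollectI ballI impI)
    fix a f assume a: "a \<in> A" and f: "f \<in> ?D" and Gf: "G f \<le> 1"
    let ?one = "\<lambda>x::'a. 1 :: real"
    have one: "?one \<in> ?B" by (rule bounded_functionsI[of _ _ 1]) simp
    have "norm (f a) powr p \<le> sup_norm A f powr p"
      using Vstar_set_norm_le_sup_norm[OF A f a] p by (intro powr_mono2) auto
    also have "\<dots> \<le> \<Lambda> (\<lambda>x. norm (f x) powr p)"
      by (rule \<Lambda>_dom[OF f])
    also have "\<dots> \<le> \<Lambda> (\<lambda>x. 1 + \<nu> f x)"
    proof (rule \<Lambda>_mono)
      show "norm (f x) powr p \<le> 1 + \<nu> f x" for x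
      proof (cases "norm (f x) \<le> 1")
        case True
        then have "norm (f x) powr p \<le> 1" using p by (intro powr_le1) auto
        then show ?thesis by (simp add: \<nu>_def add_increasing2)
      next
        case False
        then have "norm (f x) powr p \<le> norm (f x) powr real (2 * m)"
          using m by (intro powr_mono) auto
        also have "\<dots> = \<nu> f x"
          using False by (subst powr_realpow) (auto simp: \<nu>_def)
        finally show ?thesis by simp
      qed
    next
      show "(\<lambda>x. norm (f x) powr p) \<in> ?B"
        using bounded_functions_norm_power(2)[OF f] p by simp
      show "(\<lambda>x. 1 + \<nu> f x) \<in> ?B"
        by (intro bounded_functions_add one \<nu> f)
    qed
    also have "\<dots> = \<Lambda> ?one + G f"
      unfolding G_def by (intro \<Lambda>_add one \<nu> f)
    also have "\<dots> \<le> K * 1 + 1"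
      using Gf by (intro add_mono \<Lambda>_le one) auto
    finally have le: "norm (f a) powr p \<le> K + 1" by simp
    show "norm (f a) \<le> K + 1"
    proof (cases "norm (f a) \<le> 1")
      case False
      then have "norm (f a) powr 1 \<le> norm (f a) powr p"
        using p by (intro powr_mono) auto
      then show ?thesis using le False by simp
    qed (use K in simp)
  qed
  show ?thesis
  proof (rule relatively_weakly_compactI)
    show "\<exists>B. \<forall>a\<in>A. norm (f a) \<le> B" if "f \<in> ?D" for f
      using Vstar_set_norm_le_sup_norm[OF A that] by blast
  next
    fix \<eta> assume approx: "\<And>F e. finite F \<Longrightarrow> F \<subseteq> ?D \<Longrightarrow> 0 < e \<Longrightarrow>
      \<exists>a\<in>A. \<forall>f\<in>F. norm (f a - \<eta> f) < e"
    have "near \<eta> F e \<inter> polar_ball (K + 1) \<noteq> {}" if F: "finite F" "F \<subseteq> ?D" "0 < e" for F e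
    proof -
      obtain a where "a \<in> A" "\<forall>f\<in>F. norm (f a - \<eta> f) < e"
        using approx[OF F] by auto
      then have "a \<in> near \<eta> F e \<inter> polar_ball (K + 1)"
        using A_polar by (auto simp: near_def)
      then show ?thesis by auto
    qed
    then obtain x where "\<And>f. f \<in> ?D \<Longrightarrow> f x = \<eta> f"
      using pointwise_limit_is_evaluation[of \<eta> "K + 1"] by metis
    then show "\<exists>x. \<forall>f\<in>?D. f x = \<eta> f" by auto
  qed
qed

text \<open>
  The two scalar fields differ only in the construction of norming functionals.
\<close>

theorem theorem17p19:
  fixes p :: real
  assumes "1 \<le> p"
  shows "(\<forall>s :: real \<Rightarrow> 'a::banach \<Rightarrow> 'a. banach_space_over s \<longrightarrow> property_Vstar p s) \<and>
         (\<forall>s :: complex \<Rightarrow> 'b::banach \<Rightarrow> 'b. banach_space_over s \<longrightarrow> property_Vstar p s)"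
  using Vstar_set_relatively_weakly_compact[OF norming_dual_real assms]
    Vstar_set_relatively_weakly_compact[OF norming_dual_complex assms]
  by (auto simp: property_Vstar_def)

end
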